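(* Let $\Gamma$ be a groupoid, $R$ a $\Gamma$-graded ring, and $\overline{\Sigma}=(\Sigma_i)_{i\in I}\in\mathcal{P}(\Gamma)^I$ a fully matricial sequence for $R$. Then $$\mathrm{rad}^{\mathrm{gr}}\left(\mathrm{M}_I(R)(\overline{\Sigma})\right)=\mathrm{M}_I\left(\mathrm{rad}^{\mathrm{gr}}(R)\right)(\overline{\Sigma}),$$ where, for a graded ideal $U$ of $R$, $\mathrm{M}_I(U)(\overline\Sigma)$ denotes the set of matrices $(a_{ij})_{ij}\in \mathrm{M}_I(R)(\overline\Sigma)$ with $a_{ij}\in U$ for all $i,j\in I$.
   Context: A groupoid $\Gamma$ is the set of morphisms of a small category in which all morphisms are invertible; $\Gamma_0\subseteq\Gamma$ is the set of identity morphisms; $d(\gamma)=\gamma^{-1}\gamma$, $r(\gamma)=\gamma\gamma^{-1}$; the product $\gamma\delta$ is defined iff $d(\gamma)=r(\delta)$. For $\Sigma,\Sigma'\subseteq\Gamma$, $\Sigma\Sigma'$ is the set of all defined products and $\Sigma^{-1}$ the set of inverses. Rings are associative, not necessarily unital. A $\Gamma$-graded ring is a ring $R=\bigoplus_{\gamma\in\Gamma}R_\gamma$ (additive subgroups) with $R_\gamma R_\delta\subseteq R_{\gamma\delta}$ if $d(\gamma)=r(\delta)$ and $R_\gamma R_\delta=0$ otherwise; it is always assumed object unital: for each $e\in\Gamma_0$ the ring $R_e$ has an identity $1_e$ (possibly $0$) with $1_{r(\gamma)}a=a=a1_{d(\gamma)}$ for all $a\in R_\gamma$, $\gamma\in\Gamma$.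 Put $\Gamma_0'(R)=\{e\in\Gamma_0: 1_e\ne0\}$. One- or two-sided ideals $U$ are graded if $U=\bigoplus_\gamma (U\cap R_\gamma)$. For a $\Gamma$-graded ring $S$, $\mathrm{rad}^{\mathrm{gr}}(S)$ is the intersection of all gr-maximal graded right ideals of $S$ (those maximal among proper graded right ideals); it is a graded two-sided ideal. A family $\overline\Sigma=(\Sigma_i)_{i\in I}$ of nonempty subsets of $\Gamma$ is fully matricial for $R$ if: (1) for each $e\in\Gamma_0$ the set $\{i\in I: d(\sigma)=e\text{ for some }\sigma\in\Sigma_i\}$ is finite; (2) for each $i\in I$ the map $\Sigma_i\to\Gamma_0$, $\sigma\mapsto d(\sigma)$, is injective; (3) for each $i\in I$, $\sigma\mapsto r(\sigma)$ is a bijection $\Sigma_i\to\Gamma_0'(R)$. Then $\Sigma_i\gamma\Sigma_j^{-1}$ has at most one element for all $i,j\in I$, $\gamma\in\Gamma$. $\mathrm{M}_I(R)(\overline\Sigma)$ denotes the ring $\mathrm{M}_I(R)$ of $I\times I$ matrices over $R$ with finitely many nonzero entries, $\Gamma$-graded by $$\mathrm{M}_I(R)(\overline\Sigma)_\gamma=\{(a_{ij})_{ij}: a_{ij}\in R_{\Sigma_i\gamma\Sigma_j^{-1}}\ \text{for all } i,j\},$$ where $R_{\emptyset}=0$ and $R_{\{\delta\}}=R_\delta$; this is an (object unital) $\Gamma$-graded ring. *)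

theory Defs
  imports Main
begin

section \<open>Groupoids\<close>

text \<open>
  A groupoid is given by the set of all its morphisms. Composition is a total HOL function, but
  the product of \<open>x\<close> and \<open>y\<close> is regarded as defined only for morphisms with
  \<open>gdom G x = gcod G y\<close>; its other values are never used.
\<close>

record 'g groupoid_data =
  arrows :: "'g set"
  gmult :: "'g \<Rightarrow> 'g \<Rightarrow> 'g"
  ginv :: "'g \<Rightarrow> 'g"

definition gdom :: "'g groupoid_data \<Rightarrow> 'g \<Rightarrow> 'g" where
  "gdom G x = gmult G (ginv G x) x"

definition gcod :: "'g groupoid_data \<Rightarrow> 'g \<Rightarrow> 'g" where
  "gcod G x = gmult G x (ginv G x)"

text \<open>
  The axioms of a small category whose objects are identified with the identity morphisms
  (\<open>gdom G x\<close> and \<open>gcod G x\<close> being the identities at the source and target of \<open>x\<close>),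
  with \<open>ginv G\<close> as inversion.
\<close>

locale groupoid =
  fixes G :: "'g groupoid_data"
  assumes mult_closed:
      "\<lbrakk>x \<in> arrows G; y \<in> arrows G; gdom G x = gcod G y\<rbrakk> \<Longrightarrow> gmult G x y \<in> arrows G"
    and dom_mult:
      "\<lbrakk>x \<in> arrows G; y \<in> arrows G; gdom G x = gcod G y\<rbrakk> \<Longrightarrow> gdom G (gmult G x y) = gdom G y"
    and cod_mult:
      "\<lbrakk>x \<in> arrows G; y \<in> arrows G; gdom G x = gcod G y\<rbrakk> \<Longrightarrow> gcod G (gmult G x y) = gcod G x"
    and mult_assoc:
      "\<lbrakk>x \<in> arrows G; y \<in> arrows G; z \<in> arrows G; gdom G x = gcod G y; gdom G y = gcod G z\<rbrakk>
        \<Longrightarrow> gmult G (gmult G x y) z = gmult G x (gmult G y z)"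
    and dom_closed: "x \<in> arrows G \<Longrightarrow> gdom G x \<in> arrows G"
    and cod_closed: "x \<in> arrows G \<Longrightarrow> gcod G x \<in> arrows G"
    and dom_dom: "x \<in> arrows G \<Longrightarrow> gdom G (gdom G x) = gdom G x"
    and cod_dom: "x \<in> arrows G \<Longrightarrow> gcod G (gdom G x) = gdom G x"
    and dom_cod: "x \<in> arrows G \<Longrightarrow> gdom G (gcod G x) = gcod G x"
    and cod_cod: "x \<in> arrows G \<Longrightarrow> gcod G (gcod G x) = gcod G x"
    and mult_dom: "x \<in> arrows G \<Longrightarrow> gmult G x (gdom G x) = x"
    and cod_mult_self: "x \<in> arrows G \<Longrightarrow> gmult G (gcod G x) x = x"
    and inv_closed: "x \<in> arrows G \<Longrightarrow> ginv G x \<in> arrows G"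
    and dom_inv: "x \<in> arrows G \<Longrightarrow> gdom G (ginv G x) = gcod G x"
    and cod_inv: "x \<in> arrows G \<Longrightarrow> gcod G (ginv G x) = gdom G x"

definition identities :: "'g groupoid_data \<Rightarrow> 'g set" where
  "identities G = {e \<in> arrows G. gdom G e = e}"

definition set_gmult :: "'g groupoid_data \<Rightarrow> 'g set \<Rightarrow> 'g set \<Rightarrow> 'g set" where
  "set_gmult G X Y = {gmult G x y | x y. x \<in> X \<and> y \<in> Y \<and> gdom G x = gcod G y}"

definition set_ginv :: "'g groupoid_data \<Rightarrow> 'g set \<Rightarrow> 'g set" where
  "set_ginv G X = ginv G ` X"


section \<open>Graded rings\<close>

definition additive_subgroup :: "'a::ab_group_add set \<Rightarrow> bool" where
  "additive_subgroup S \<longleftrightarrow> 0 \<in> S \<and> (\<forall>a\<in>S. \<forall>b\<in>S. a + b \<in> S) \<and> (\<forall>a\<in>S. - a \<in> S)"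

text \<open>\<open>S\<close> is the internal direct sum of the additive subgroups \<open>M x\<close>, \<open>x \<in> X\<close>.\<close>

definition is_direct_sum :: "'g set \<Rightarrow> ('g \<Rightarrow> 'a::ab_group_add set) \<Rightarrow> 'a set \<Rightarrow> bool" where
  "is_direct_sum X M S \<longleftrightarrow>
     additive_subgroup S \<and>
     (\<forall>x\<in>X. additive_subgroup (M x) \<and> M x \<subseteq> S) \<and>
     (\<forall>a\<in>S. \<exists>!f. (\<forall>x\<in>X. f x \<in> M x) \<and> (\<forall>x. x \<notin> X \<longrightarrow> f x = 0) \<and>
        finite {x. f x \<noteq> 0} \<and> a = (\<Sum>x | f x \<noteq> 0. f x))"

text \<open>
  The class \<open>ring\<close> does not require an identity element. A ring is a subset \<open>total R\<close>
  of a type of this class, with the induced operations.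
\<close>

record ('g, 'a) graded_data =
  total :: "'a set"
  component :: "'g \<Rightarrow> 'a set"

definition is_unit_of :: "'a::ring set \<Rightarrow> 'a \<Rightarrow> bool" where
  "is_unit_of S u \<longleftrightarrow> u \<in> S \<and> (\<forall>a\<in>S. u * a = a \<and> a * u = a)"

definition unit_at :: "('g, 'a::ring) graded_data \<Rightarrow> 'g \<Rightarrow> 'a" where
  "unit_at R e = (THE u. is_unit_of (component R e) u)"

text \<open>Object unital graded rings; the condition on units is part of the definition.\<close>

definition graded_ring :: "'g groupoid_data \<Rightarrow> ('g, 'a::ring) graded_data \<Rightarrow> bool" where
  "graded_ring G R \<longleftrightarrow>
     (\<forall>a\<in>total R. \<forall>b\<in>total R. a * b \<in> total R) \<and>
     is_direct_sum (arrows G) (component R) (total R) \<and>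
     (\<forall>x\<in>arrows G. \<forall>y\<in>arrows G. \<forall>a\<in>component R x. \<forall>b\<in>component R y.
        if gdom G x = gcod G y then a * b \<in> component R (gmult G x y) else a * b = 0) \<and>
     (\<forall>e\<in>identities G. \<exists>u. is_unit_of (component R e) u) \<and>
     (\<forall>x\<in>arrows G. \<forall>a\<in>component R x.
        unit_at R (gcod G x) * a = a \<and> a * unit_at R (gdom G x) = a)"

definition nonzero_identities :: "'g groupoid_data \<Rightarrow> ('g, 'a::ring) graded_data \<Rightarrow> 'g set" where
  "nonzero_identities G R = {e \<in> identities G. unit_at R e \<noteq> 0}"


section \<open>The graded Jacobson radical\<close>

definition right_ideal_of :: "'a::ring set \<Rightarrow> 'a set \<Rightarrow> bool" where
  "right_ideal_of U S \<longleftrightarrow>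
     U \<subseteq> S \<and> additive_subgroup U \<and> (\<forall>u\<in>U. \<forall>a\<in>S. u * a \<in> U)"

definition graded_right_ideal ::
    "'g groupoid_data \<Rightarrow> ('g, 'a::ring) graded_data \<Rightarrow> 'a set \<Rightarrow> bool" where
  "graded_right_ideal G R U \<longleftrightarrow>
     right_ideal_of U (total R) \<and>
     is_direct_sum (arrows G) (\<lambda>x. U \<inter> component R x) U"

definition gr_maximal_right_ideal ::
    "'g groupoid_data \<Rightarrow> ('g, 'a::ring) graded_data \<Rightarrow> 'a set \<Rightarrow> bool" where
  "gr_maximal_right_ideal G R U \<longleftrightarrow>
     graded_right_ideal G R U \<and> U \<noteq> total R \<and>
     (\<forall>V. graded_right_ideal G R V \<and> V \<noteq> total R \<and> U \<subseteq> V \<longrightarrow> V = U)"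

text \<open>The intersection is taken inside the ring, so it is the whole ring if there are no
  gr-maximal graded right ideals.\<close>

definition gr_rad :: "'g groupoid_data \<Rightarrow> ('g, 'a::ring) graded_data \<Rightarrow> 'a set" where
  "gr_rad G R = {a \<in> total R. \<forall>U. gr_maximal_right_ideal G R U \<longrightarrow> a \<in> U}"


section \<open>Matrices with finitely many nonzero entries\<close>

typedef (overloaded) ('i, 'a) fin_matrix =
  "{A :: 'i \<Rightarrow> 'i \<Rightarrow> 'a::zero. finite {(i, j). A i j \<noteq> 0}}"
  morphisms entry Abs_fin_matrix
  by (rule exI[of _ "\<lambda>i j. 0"]) simp

setup_lifting type_definition_fin_matrix

lemma fin_matrix_eqI: "(\<And>i j. entry A i j = entry B i j) \<Longrightarrow> A = B"
  by (metis entry_inject ext)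

lemma finite_support_row:
  assumes "finite {(i, j). A i j \<noteq> (0::'a::zero)}"
  shows "finite {k. A i k \<noteq> 0}"
proof -
  have "{k. A i k \<noteq> 0} \<subseteq> snd ` {(i, j). A i j \<noteq> 0}" by force
  then show ?thesis using assms finite_surj by blast
qed

lemma finite_row: "finite {k. entry A i k \<noteq> 0}"
  using entry[of A] by (auto intro: finite_support_row)

instantiation fin_matrix :: (type, ab_group_add) ab_group_add
begin

lift_definition zero_fin_matrix :: "('a, 'b) fin_matrix" is "\<lambda>i j. 0" by simp

lift_definition plus_fin_matrix ::
    "('a, 'b) fin_matrix \<Rightarrow> ('a, 'b) fin_matrix \<Rightarrow> ('a, 'b) fin_matrix"
  is "\<lambda>A B i j. A i j + B i j"
proof -
  fix A B :: "'a \<Rightarrow> 'a \<Rightarrow> 'b"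
  assume "finite {(i, j). A i j \<noteq> 0}" "finite {(i, j). B i j \<noteq> 0}"
  then have "finite ({(i, j). A i j \<noteq> 0} \<union> {(i, j). B i j \<noteq> 0})" by simp
  then show "finite {(i, j). A i j + B i j \<noteq> 0}"
    by (rule rev_finite_subset) auto
qed

lift_definition uminus_fin_matrix :: "('a, 'b) fin_matrix \<Rightarrow> ('a, 'b) fin_matrix"
  is "\<lambda>A i j. - A i j" by simp

lift_definition minus_fin_matrix ::
    "('a, 'b) fin_matrix \<Rightarrow> ('a, 'b) fin_matrix \<Rightarrow> ('a, 'b) fin_matrix"
  is "\<lambda>A B i j. A i j - B i j"
proof -
  fix A B :: "'a \<Rightarrow> 'a \<Rightarrow> 'b"
  assume "finite {(i, j). A i j \<noteq> 0}" "finite {(i, j). B i j \<noteq> 0}"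
  then have "finite ({(i, j). A i j \<noteq> 0} \<union> {(i, j). B i j \<noteq> 0})" by simp
  then show "finite {(i, j). A i j - B i j \<noteq> 0}"
    by (rule rev_finite_subset) auto
qed

instance
  by standard (rule fin_matrix_eqI; simp add: zero_fin_matrix.rep_eq plus_fin_matrix.rep_eq
    uminus_fin_matrix.rep_eq minus_fin_matrix.rep_eq add_ac)+

end

instantiation fin_matrix :: (type, ring) ring
begin

lift_definition times_fin_matrix ::
    "('a, 'b) fin_matrix \<Rightarrow> ('a, 'b) fin_matrix \<Rightarrow> ('a, 'b) fin_matrix"
  is "\<lambda>A B i j. \<Sum>k | A i k \<noteq> 0. A i k * B k j"
proof -
  fix A B :: "'a \<Rightarrow> 'a \<Rightarrow> 'b"
  assume fin: "finite {(i, j). A i j \<noteq> 0}" "finite {(i, j). B i j \<noteq> 0}"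
  have "{(i, j). (\<Sum>k | A i k \<noteq> 0. A i k * B k j) \<noteq> 0}
      \<subseteq> fst ` {(i, j). A i j \<noteq> 0} \<times> snd ` {(i, j). B i j \<noteq> 0}"
  proof
    fix p assume "p \<in> {(i, j). (\<Sum>k | A i k \<noteq> 0. A i k * B k j) \<noteq> 0}"
    then obtain i j where p: "p = (i, j)" and "(\<Sum>k | A i k \<noteq> 0. A i k * B k j) \<noteq> 0"
      by blast
    then obtain k where "A i k * B k j \<noteq> 0" by (meson sum.neutral)
    then have "A i k \<noteq> 0" "B k j \<noteq> 0" by auto
    then show "p \<in> fst ` {(i, j). A i j \<noteq> 0} \<times> snd ` {(i, j). B i j \<noteq> 0}"
      unfolding p by force
  qed
  then show "finite {(i, j). (\<Sum>k | A i k \<noteq> 0. A i k * B k j) \<noteq> 0}"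
    using fin by (meson finite_SigmaI finite_imageI finite_subset)
qed

lemma entry_times_superset:
  assumes "finite K" "{k. entry A i k \<noteq> 0} \<subseteq> K"
  shows "entry (A * B) i j = (\<Sum>k\<in>K. entry A i k * entry B k j)"
  unfolding times_fin_matrix.rep_eq
  by (rule sum.mono_neutral_left) (use assms in auto)

instance
proof
  fix A B C :: "('a, 'b) fin_matrix"
  show "A * B * C = A * (B * C)"
  proof (rule fin_matrix_eqI)
    fix i j
    let ?K = "{k. entry A i k \<noteq> 0}"
    let ?L = "(\<Union>k\<in>?K. {l. entry B k l \<noteq> 0})"
    have K: "finite ?K" by (rule finite_row)
    have L: "finite ?L" using K by (simp add: finite_row)
    have AB: "entry (A * B) i l = (\<Sum>k\<in>?K. entry A i k * entry B k l)" for l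
      by (rule entry_times_superset[OF K]) simp
    have sub: "{l. entry (A * B) i l \<noteq> 0} \<subseteq> ?L"
    proof
      fix l assume "l \<in> {l. entry (A * B) i l \<noteq> 0}"
      then have "(\<Sum>k\<in>?K. entry A i k * entry B k l) \<noteq> 0" by (simp add: AB)
      then obtain k where "k \<in> ?K" "entry A i k * entry B k l \<noteq> 0" by (meson sum.neutral)
      then show "l \<in> ?L" by auto
    qed
    have BC: "entry (B * C) k j = (\<Sum>l\<in>?L. entry B k l * entry C l j)" if "k \<in> ?K" for k
      by (rule entry_times_superset[OF L]) (use that in auto)
    have "entry (A * B * C) i j = (\<Sum>l\<in>?L. entry (A * B) i l * entry C l j)"
      by (rule entry_times_superset[OF L sub])
    also have "\<dots> = (\<Sum>l\<in>?L. \<Sum>k\<in>?K. entry A i k * (entry B k l * entry C l j))"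
      unfolding AB sum_distrib_right mult.assoc ..
    also have "\<dots> = (\<Sum>k\<in>?K. \<Sum>l\<in>?L. entry A i k * (entry B k l * entry C l j))"
      by (rule sum.swap)
    also have "\<dots> = (\<Sum>k\<in>?K. entry A i k * entry (B * C) k j)"
      by (rule sum.cong[OF refl]) (simp add: BC sum_distrib_left)
    also have "\<dots> = entry (A * (B * C)) i j"
      by (rule entry_times_superset[OF K, symmetric]) simp
    finally show "entry (A * B * C) i j = entry (A * (B * C)) i j" .
  qed
  show "(A + B) * C = A * C + B * C"
  proof (rule fin_matrix_eqI)
    fix i j
    let ?K = "{k. entry A i k \<noteq> 0} \<union> {k. entry B i k \<noteq> 0}"
    have K: "finite ?K" by (simp add: finite_row)
    have "{k. entry (A + B) i k \<noteq> 0} \<subseteq> ?K" by (auto simp: plus_fin_matrix.rep_eq)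
    then have "entry ((A + B) * C) i j = (\<Sum>k\<in>?K. entry (A + B) i k * entry C k j)"
      by (rule entry_times_superset[OF K])
    also have "\<dots> = (\<Sum>k\<in>?K. entry A i k * entry C k j) + (\<Sum>k\<in>?K. entry B i k * entry C k j)"
      by (simp add: plus_fin_matrix.rep_eq distrib_right sum.distrib)
    also have "\<dots> = entry (A * C + B * C) i j"
      by (simp add: plus_fin_matrix.rep_eq entry_times_superset[OF K])
    finally show "entry ((A + B) * C) i j = entry (A * C + B * C) i j" .
  qed
  show "A * (B + C) = A * B + A * C"
    by (rule fin_matrix_eqI)
      (simp add: times_fin_matrix.rep_eq plus_fin_matrix.rep_eq distrib_left sum.distrib)
qed

end


section \<open>Graded matrix rings\<close>

definition fully_matricial ::
    "'g groupoid_data \<Rightarrow> ('g, 'a::ring) graded_data \<Rightarrow> 'i set \<Rightarrow> ('i \<Rightarrow> 'g set) \<Rightarrow> bool" where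
  "fully_matricial G R I \<Sigma> \<longleftrightarrow>
     (\<forall>i\<in>I. \<Sigma> i \<noteq> {} \<and> \<Sigma> i \<subseteq> arrows G) \<and>
     (\<forall>e\<in>identities G. finite {i \<in> I. \<exists>s\<in>\<Sigma> i. gdom G s = e}) \<and>
     (\<forall>i\<in>I. inj_on (gdom G) (\<Sigma> i)) \<and>
     (\<forall>i\<in>I. bij_betw (gcod G) (\<Sigma> i) (nonzero_identities G R))"

text \<open>Only applied to sets with at most one element.\<close>

definition component_of_set :: "('g, 'a::ring) graded_data \<Rightarrow> 'g set \<Rightarrow> 'a set" where
  "component_of_set R X = (if X = {} then {0} else component R (the_elem X))"

text \<open>\<open>I \<times> I\<close> matrices are represented by matrices over the type that vanish off \<open>I \<times> I\<close>.\<close>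

definition matrices :: "'i set \<Rightarrow> 'a::ring set \<Rightarrow> ('i, 'a) fin_matrix set" where
  "matrices I S =
     {A. (\<forall>i\<in>I. \<forall>j\<in>I. entry A i j \<in> S) \<and> (\<forall>i j. i \<notin> I \<or> j \<notin> I \<longrightarrow> entry A i j = 0)}"

definition matrix_graded ::
    "'g groupoid_data \<Rightarrow> ('g, 'a::ring) graded_data \<Rightarrow> 'i set \<Rightarrow> ('i \<Rightarrow> 'g set)
      \<Rightarrow> ('g, ('i, 'a) fin_matrix) graded_data" where
  "matrix_graded G R I \<Sigma> =
     \<lparr>total = matrices I (total R),
      component = (\<lambda>x. {A \<in> matrices I (total R). \<forall>i\<in>I. \<forall>j\<in>I.
        entry A i j \<in>
          component_of_set R (set_gmult G (set_gmult G (\<Sigma> i) {x}) (set_ginv G (\<Sigma> j)))})\<rparr>"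

definition matrix_ideal ::
    "'g groupoid_data \<Rightarrow> ('g, 'a::ring) graded_data \<Rightarrow> 'i set \<Rightarrow> ('i \<Rightarrow> 'g set) \<Rightarrow> 'a set
      \<Rightarrow> ('i, 'a) fin_matrix set" where
  "matrix_ideal G R I \<Sigma> U =
     {A \<in> total (matrix_graded G R I \<Sigma>). \<forall>i\<in>I. \<forall>j\<in>I. entry A i j \<in> U}"

end

theory Submission
  imports Defs
begin

text \<open>
  A homogeneous \<open>a \<in> R\<^sub>x\<close> lies in the graded radical iff, with \<open>e = r(x)\<close>, the element
  \<open>1\<^sub>e - a b\<close> is right invertible in \<open>R\<^sub>e\<close> for all \<open>b \<in> R\<close> of degree \<open>x\<^sup>-\<^sup>1\<close>. Applying
  this to \<open>R\<close> and to the matrix ring, both inclusions can be tested on homogeneous matrices. For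
  one of them multiply a matrix of the radical by matrices with a single nonzero entry; for the
  other split a matrix over the radical of \<open>R\<close> into its rows, for which right inverses can be
  written down explicitly.
\<close>

section \<open>Groupoids\<close>

text \<open>Neither \<open>R\<close> nor the matrix ring need have an identity. Invertibility is
  therefore always tested inside one ring \<open>R_e\<close>, and Zorn's lemma runs over graded
  right ideals that omit \<open>1_e\<close>, since properness alone may be lost in the union of a
  chain.

  For a full matrix \<open>X\<close> over the radical, a right inverse of \<open>1 - X\<close> would
  call for an elimination through several rows. If \<open>X\<close> sits in row \<open>i\<close>,
  only the scalar \<open>1 - x_ii\<close> has to be inverted. Moreover row \<open>i\<close> of
  \<open>A B\<close> consists of sums of right multiples of entries of \<open>A\<close>, so its
  entries stay in the radical.

  The bookkeeping of degrees rests on one fact. At a fixed position \<open>(i, j)\<close> the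
  partial map \<open>x \<mapsto> s x t^-1\<close> is well defined by the injectivity of
  \<open>d\<close> on each \<open>\<Sigma> i\<close>, injective by that of \<open>r\<close>, and
  hits every degree whose two local units are nonzero. Hence the decomposition of each entry into
  homogeneous parts can be transported to the whole matrix.\<close>

context groupoid
begin

lemma inv_mult_cancel:
  assumes "x \<in> arrows G" "y \<in> arrows G" "gdom G x = gcod G y"
  shows "gmult G (ginv G x) (gmult G x y) = y"
proof -
  have "gmult G (ginv G x) (gmult G x y) = gmult G (gdom G x) y"
    using mult_assoc[of "ginv G x" x y] assms by (simp add: inv_closed dom_inv gdom_def[of G x])
  then show ?thesis using assms by (simp add: cod_mult_self)
qed

lemma mult_inv_cancel:
  assumes "x \<in> arrows G" "z \<in> arrows G" "gcod G x = gcod G z"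
  shows "gmult G x (gmult G (ginv G x) z) = z"
proof -
  have "gmult G x (gmult G (ginv G x) z) = gmult G (gcod G x) z"
    using mult_assoc[of x "ginv G x" z] assms
    by (simp add: inv_closed dom_inv cod_inv gcod_def[of G x])
  then show ?thesis using assms by (simp add: cod_mult_self)
qed

lemma mult_inv_cancel_right:
  assumes "x \<in> arrows G" "y \<in> arrows G" "gdom G x = gdom G y"
  shows "gmult G (gmult G x (ginv G y)) y = x"
proof -
  have "gmult G (gmult G x (ginv G y)) y = gmult G x (gdom G y)"
    using mult_assoc[of x "ginv G y" y] assms
    by (simp add: inv_closed dom_inv cod_inv gdom_def[of G y])
  then show ?thesis using assms by (metis mult_dom)
qed

lemma inverse_unique:
  assumes "x \<in> arrows G" "y \<in> arrows G" "gdom G x = gcod G y" "gmult G x y = gcod G x"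
  shows "y = ginv G x"
  using inv_mult_cancel[OF assms(1-3)] mult_dom[of "ginv G x"] assms
  by (simp add: inv_closed dom_inv)

lemma mult_inv: "gmult G x (ginv G x) = gcod G x"
  by (simp add: gcod_def)

lemma identitiesD:
  assumes "e \<in> identities G"
  shows "e \<in> arrows G" "gdom G e = e" "gcod G e = e"
  using assms cod_dom[of e] by (auto simp: identities_def)

lemma ginv_identity: "e \<in> identities G \<Longrightarrow> ginv G e = e"
  using identitiesD[of e] inverse_unique[of e e] mult_dom[of e] by simp

lemma cod_identity: "x \<in> arrows G \<Longrightarrow> gcod G x \<in> identities G"
  by (simp add: identities_def cod_closed dom_cod)

lemma dom_identity: "x \<in> arrows G \<Longrightarrow> gdom G x \<in> identities G"
  by (simp add: identities_def dom_closed dom_dom)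

end

section \<open>Direct sums\<close>

lemma additive_subgroupD:
  assumes "additive_subgroup S"
  shows "0 \<in> S" "a \<in> S \<Longrightarrow> b \<in> S \<Longrightarrow> a + b \<in> S" "a \<in> S \<Longrightarrow> - a \<in> S"
    "a \<in> S \<Longrightarrow> b \<in> S \<Longrightarrow> a - b \<in> S"
proof -
  show "0 \<in> S" using assms by (simp add: additive_subgroup_def)
  show add: "a + b \<in> S" if "a \<in> S" "b \<in> S" for a b
    using assms that by (simp add: additive_subgroup_def)
  show neg: "- a \<in> S" if "a \<in> S" for a
    using assms that by (simp add: additive_subgroup_def)
  show "a - b \<in> S" if "a \<in> S" "b \<in> S"
    using add[OF that(1) neg[OF that(2)]] by simp
qed

lemma additive_subgroup_sum:
  assumes "additive_subgroup S" "\<And>k. k \<in> K \<Longrightarrow> f k \<in> S"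
  shows "sum f K \<in> S"
  using assms(2)
  by (induction K rule: infinite_finite_induct) (auto simp: additive_subgroupD[OF assms(1)])

text \<open>Requiring \<open>f\<close> to vanish off \<open>X\<close> fixes it as a total function,
  so that uniqueness is plain equality and \<open>THE\<close> applies.\<close>

definition decomposition ::
    "'g set \<Rightarrow> ('g \<Rightarrow> 'a::ab_group_add set) \<Rightarrow> 'a \<Rightarrow> ('g \<Rightarrow> 'a) \<Rightarrow> bool" where
  "decomposition X M a f \<longleftrightarrow>
     (\<forall>x\<in>X. f x \<in> M x) \<and> (\<forall>x. x \<notin> X \<longrightarrow> f x = 0) \<and>
     finite {x. f x \<noteq> 0} \<and> a = (\<Sum>x | f x \<noteq> 0. f x)"

definition summand ::
    "'g set \<Rightarrow> ('g \<Rightarrow> 'a::ab_group_add set) \<Rightarrow> 'a \<Rightarrow> 'g \<Rightarrow> 'a" where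
  "summand X M a = (THE f. decomposition X M a f)"

lemma is_direct_sum_iff:
  "is_direct_sum X M S \<longleftrightarrow> additive_subgroup S \<and>
     (\<forall>x\<in>X. additive_subgroup (M x) \<and> M x \<subseteq> S) \<and> (\<forall>a\<in>S. \<exists>!f. decomposition X M a f)"
  by (simp add: is_direct_sum_def decomposition_def)

text \<open>Uniqueness comes from projections: \<open>p x\<close> applied to any decomposition kills
  every summand but the one at \<open>x\<close>, so \<open>f x = p x a\<close>. Both later uses have
  explicit projections at hand: the components of a larger direct sum, and entrywise projections of
  matrices.\<close>

lemma is_direct_sumI:
  assumes S: "additive_subgroup S"
    and M: "\<And>x. x \<in> X \<Longrightarrow> additive_subgroup (M x)" "\<And>x. x \<in> X \<Longrightarrow> M x \<subseteq> S"
    and p_add: "\<And>x a b. x \<in> X \<Longrightarrow> a \<in> S \<Longrightarrow> b \<in> S \<Longrightarrow> p x (a + b) = p x a + p x b"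
    and p_same: "\<And>x a. x \<in> X \<Longrightarrow> a \<in> M x \<Longrightarrow> p x a = a"
    and p_other: "\<And>x y a. x \<in> X \<Longrightarrow> y \<in> X \<Longrightarrow> x \<noteq> y \<Longrightarrow> a \<in> M y \<Longrightarrow> p x a = 0"
    and p_decomp: "\<And>a. a \<in> S \<Longrightarrow> decomposition X M a (\<lambda>x. p x a)"
  shows "is_direct_sum X M S"
  unfolding is_direct_sum_iff
proof (intro conjI ballI)
  fix a assume a: "a \<in> S"
  show "\<exists>!f. decomposition X M a f"
  proof (rule ex1I[where a = "\<lambda>x. p x a"])
    show "decomposition X M a (\<lambda>x. p x a)" using p_decomp[OF a] .
  next
    fix f assume f: "decomposition X M a f"
    have f_in: "f x \<in> M x" if "x \<in> X" for x
      using f that unfolding decomposition_def by blast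
    \<comment> \<open>\<open>p x\<close> is additive on \<open>S\<close> only, so the induction has
      to keep the partial sums in \<open>S\<close>.\<close>
    have p_sum: "p x (sum f K) = (\<Sum>k\<in>K. p x (f k))"
      if "x \<in> X" "finite K" "K \<subseteq> X" for x K
      using that(2,3)
    proof (induction K)
      case empty
      have "0 \<in> S" using additive_subgroupD(1)[OF S] .
      from p_add[OF that(1) this this] have "p x 0 = 0" by simp
      then show ?case by simp
    next
      case (insert k K)
      have kX: "k \<in> X" "\<And>l. l \<in> K \<Longrightarrow> l \<in> X" using insert.prems by auto
      have fS: "f k \<in> S" using M(2)[OF kX(1)] f_in[OF kX(1)] by blast
      have "sum f K \<in> S"
        by (rule additive_subgroup_sum[OF S]) (use M(2) f_in kX(2) in blast)
      from p_add[OF that(1) fS this] show ?case using insert.IH insert.hyps kX(2) by (simp add: subset_iff)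
    qed
    show "f = (\<lambda>x. p x a)"
    proof
      fix x
      show "f x = p x a"
      proof (cases "x \<in> X")
        case True
        let ?K = "{x. f x \<noteq> 0}"
        have K: "finite ?K" "?K \<subseteq> X" "a = sum f ?K"
          using f unfolding decomposition_def by blast+
        have "p x a = p x (sum f ?K)" using K(3) by (rule arg_cong)
        also have "\<dots> = (\<Sum>k\<in>?K. p x (f k))" by (rule p_sum[OF True K(1,2)])
        also have "\<dots> = (\<Sum>k\<in>?K. if k = x then f x else 0)"
        proof (rule sum.cong)
          fix k assume "k \<in> ?K"
          then have "k \<in> X" using K(2) by blast
          then show "p x (f k) = (if k = x then f x else 0)"
            using p_same[OF True f_in[OF True]] p_other[OF True \<open>k \<in> X\<close> _ f_in] by simp
        qed simp
        also have "\<dots> = f x" using K(1) by simp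
        finally show ?thesis by simp
      next
        case False
        have "f x = 0" using f False unfolding decomposition_def by blast
        moreover have "p x a = 0" using p_decomp[OF a] False unfolding decomposition_def by blast
        ultimately show ?thesis by simp
      qed
    qed
  qed
next
  show "additive_subgroup S" by (rule S)
  show "additive_subgroup (M x)" "M x \<subseteq> S" if "x \<in> X" for x using M[OF that] .
qed

context
  fixes X :: "'g set" and M :: "'g \<Rightarrow> 'a::ab_group_add set" and S :: "'a set"
  assumes ds: "is_direct_sum X M S"
begin

lemma summand_decomposition: "a \<in> S \<Longrightarrow> decomposition X M a (summand X M a)"
  using ds unfolding is_direct_sum_iff summand_def by (metis theI')

lemma summand_unique: "a \<in> S \<Longrightarrow> decomposition X M a f \<Longrightarrow> summand X M a = f"
  using ds summand_decomposition unfolding is_direct_sum_iff by metis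

lemma summand_in: "a \<in> S \<Longrightarrow> x \<in> X \<Longrightarrow> summand X M a x \<in> M x"
  using summand_decomposition unfolding decomposition_def by blast

lemma summand_outside: "a \<in> S \<Longrightarrow> x \<notin> X \<Longrightarrow> summand X M a x = 0"
  using summand_decomposition unfolding decomposition_def by blast

lemma finite_summand: "a \<in> S \<Longrightarrow> finite {x. summand X M a x \<noteq> 0}"
  using summand_decomposition unfolding decomposition_def by blast

lemma sum_summand: "a \<in> S \<Longrightarrow> (\<Sum>x | summand X M a x \<noteq> 0. summand X M a x) = a"
  using summand_decomposition[of a] unfolding decomposition_def by metis

lemma summand_homogeneous:
  assumes "x \<in> X" "a \<in> M x"
  shows "summand X M a y = (if y = x then a else 0)"
proof -
  have sub: "additive_subgroup (M y)" if "y \<in> X" for y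
    using ds that by (auto simp: is_direct_sum_iff)
  have aS: "a \<in> S" using ds assms by (auto simp: is_direct_sum_iff)
  let ?f = "\<lambda>y. if y = x then a else 0"
  have K: "{y. ?f y \<noteq> 0} \<subseteq> {x}" by auto
  have "(\<Sum>y | ?f y \<noteq> 0. ?f y) = (\<Sum>y\<in>{x}. ?f y)"
    by (rule sum.mono_neutral_left) auto
  then have "decomposition X M a ?f"
    using assms additive_subgroupD(1)[OF sub] finite_subset[OF K]
    by (auto simp: decomposition_def)
  from summand_unique[OF aS this] show ?thesis by simp
qed

lemma summand_zero: "summand X M 0 x = 0"
proof -
  have 0: "0 \<in> M y" if "y \<in> X" for y
    using ds that additive_subgroupD(1) by (auto simp: is_direct_sum_iff)
  have "0 \<in> S" using ds additive_subgroupD(1) by (auto simp: is_direct_sum_iff)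
  moreover have "decomposition X M 0 (\<lambda>x. 0)" using 0 by (auto simp: decomposition_def)
  ultimately show ?thesis by (simp add: summand_unique)
qed

lemma summand_add:
  assumes "a \<in> S" "b \<in> S"
  shows "summand X M (a + b) x = summand X M a x + summand X M b x"
proof -
  let ?a = "summand X M a" and ?b = "summand X M b"
  have sub: "additive_subgroup (M y)" if "y \<in> X" for y
    using ds that by (auto simp: is_direct_sum_iff)
  have abS: "a + b \<in> S" using ds assms additive_subgroupD(2) by (auto simp: is_direct_sum_iff)
  \<comment> \<open>Cancellation may shrink the support of the sum, so all three sums are taken over
    one common finite set.\<close>
  let ?K = "{y. ?a y \<noteq> 0} \<union> {y. ?b y \<noteq> 0}"
  have K: "finite ?K" using finite_summand assms by simp
  have sup: "sum g {y. g y \<noteq> 0} = sum g ?K" if "{y. g y \<noteq> 0} \<subseteq> ?K" for g :: "'g \<Rightarrow> 'a"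
    by (rule sum.mono_neutral_left) (use K that in auto)
  have "(\<Sum>y | ?a y + ?b y \<noteq> 0. ?a y + ?b y) = (\<Sum>y\<in>?K. ?a y + ?b y)"
    by (rule sup) auto
  also have "\<dots> = a + b"
    using sum_summand[OF assms(1)] sum_summand[OF assms(2)] sup[of ?a] sup[of ?b]
    by (simp add: sum.distrib)
  finally have "decomposition X M (a + b) (\<lambda>y. ?a y + ?b y)"
    using assms sub
    by (auto simp: decomposition_def summand_in summand_outside additive_subgroupD
        intro: finite_subset[OF _ K])
  from summand_unique[OF abS this] show ?thesis by simp
qed

lemma summand_sum:
  assumes "\<And>k. k \<in> K \<Longrightarrow> f k \<in> S"
  shows "summand X M (sum f K) x = (\<Sum>k\<in>K. summand X M (f k) x)"
proof -
  have S: "additive_subgroup S" using ds by (auto simp: is_direct_sum_iff)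
  show ?thesis using assms
    by (induction K rule: infinite_finite_induct)
      (simp_all add: summand_zero summand_add additive_subgroup_sum[OF S])
qed

text \<open>A decomposition inside \<open>U\<close> is also one in \<open>S\<close>, hence the only
  one. Gradedness thus becomes closure under taking components, a condition that passes to unions of
  chains.\<close>

lemma is_direct_sum_Int_iff:
  assumes "U \<subseteq> S" "additive_subgroup U"
  shows "is_direct_sum X (\<lambda>x. U \<inter> M x) U \<longleftrightarrow> (\<forall>a\<in>U. \<forall>x\<in>X. summand X M a x \<in> U)"
proof
  assume L: "is_direct_sum X (\<lambda>x. U \<inter> M x) U"
  show "\<forall>a\<in>U. \<forall>x\<in>X. summand X M a x \<in> U"
  proof (intro ballI)
    fix a x assume a: "a \<in> U" and x: "x \<in> X"
    obtain f where f: "decomposition X (\<lambda>x. U \<inter> M x) a f"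
      using L a unfolding is_direct_sum_iff by blast
    then have "decomposition X M a f" unfolding decomposition_def by blast
    with summand_unique a assms(1) have "summand X M a = f" by blast
    then show "summand X M a x \<in> U" using f x unfolding decomposition_def by blast
  qed
next
  assume R: "\<forall>a\<in>U. \<forall>x\<in>X. summand X M a x \<in> U"
  have sub: "additive_subgroup (M y)" if "y \<in> X" for y
    using ds that by (auto simp: is_direct_sum_iff)
  show "is_direct_sum X (\<lambda>x. U \<inter> M x) U"
  proof (rule is_direct_sumI[where p = "\<lambda>x a. summand X M a x"])
    show "additive_subgroup (U \<inter> M x)" if "x \<in> X" for x
      using sub[OF that] assms(2) by (auto simp: additive_subgroup_def)
    show "decomposition X (\<lambda>x. U \<inter> M x) a (\<lambda>x. summand X M a x)" if "a \<in> U" for a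
      using summand_decomposition[of a] that R assms(1) unfolding decomposition_def by blast
  qed (use assms summand_homogeneous in \<open>auto intro!: summand_add\<close>)
qed

end

section \<open>Object unital graded rings and their graded radical\<close>

locale object_unital_ring = groupoid G
  for G :: "'g groupoid_data" +
  fixes R :: "('g, 'a::ring) graded_data"
  assumes graded: "graded_ring G R"
begin

abbreviation hcomp :: "'a \<Rightarrow> 'g \<Rightarrow> 'a" where
  "hcomp \<equiv> summand (arrows G) (component R)"

lemma direct_sum: "is_direct_sum (arrows G) (component R) (total R)"
  using graded unfolding graded_ring_def by blast

lemma total_subgroup: "additive_subgroup (total R)"
  using direct_sum by (simp add: is_direct_sum_iff)

lemma component_subgroup: "x \<in> arrows G \<Longrightarrow> additive_subgroup (component R x)"
  using direct_sum by (simp add: is_direct_sum_iff)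

lemma component_total: "x \<in> arrows G \<Longrightarrow> a \<in> component R x \<Longrightarrow> a \<in> total R"
  using direct_sum by (auto simp: is_direct_sum_iff)

lemma mult_total: "a \<in> total R \<Longrightarrow> b \<in> total R \<Longrightarrow> a * b \<in> total R"
  using graded unfolding graded_ring_def by blast

lemma mult_component:
  "\<lbrakk>x \<in> arrows G; y \<in> arrows G; a \<in> component R x; b \<in> component R y; gdom G x = gcod G y\<rbrakk>
    \<Longrightarrow> a * b \<in> component R (gmult G x y)"
  using graded unfolding graded_ring_def by meson

lemma mult_eq_0:
  "\<lbrakk>x \<in> arrows G; y \<in> arrows G; a \<in> component R x; b \<in> component R y; gdom G x \<noteq> gcod G y\<rbrakk>
    \<Longrightarrow> a * b = 0"
  using graded unfolding graded_ring_def by meson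

lemma unit_left: "x \<in> arrows G \<Longrightarrow> a \<in> component R x \<Longrightarrow> unit_at R (gcod G x) * a = a"
  using graded unfolding graded_ring_def by meson

lemma unit_right: "x \<in> arrows G \<Longrightarrow> a \<in> component R x \<Longrightarrow> a * unit_at R (gdom G x) = a"
  using graded unfolding graded_ring_def by meson

lemma unit_component:
  assumes "e \<in> identities G"
  shows "unit_at R e \<in> component R e"
proof -
  obtain u where u: "is_unit_of (component R e) u"
    using graded assms unfolding graded_ring_def by meson
  have "is_unit_of (component R e) (unit_at R e)"
    unfolding unit_at_def using u by (rule theI) (metis u is_unit_of_def)
  then show ?thesis by (simp add: is_unit_of_def)
qed

text \<open>A nonzero element is not fixed by a zero unit. This ties the degrees occurring in
  \<open>R\<close> to the set onto which \<open>r\<close> maps every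
  \<open>\<Sigma> i\<close>.\<close>

lemma nonzero_ends:
  assumes "x \<in> arrows G" "a \<in> component R x" "a \<noteq> 0"
  shows "gcod G x \<in> nonzero_identities G R" "gdom G x \<in> nonzero_identities G R"
  using unit_left[OF assms(1,2)] unit_right[OF assms(1,2)] assms(3)
  unfolding nonzero_identities_def
  by (auto simp: cod_identity[OF assms(1)] dom_identity[OF assms(1)])

lemma hcomp_component: "a \<in> total R \<Longrightarrow> x \<in> arrows G \<Longrightarrow> hcomp a x \<in> component R x"
  by (rule summand_in[OF direct_sum])

lemma hcomp_total: "a \<in> total R \<Longrightarrow> x \<in> arrows G \<Longrightarrow> hcomp a x \<in> total R"
  using hcomp_component component_total by blast

lemma hcomp_outside: "a \<in> total R \<Longrightarrow> x \<notin> arrows G \<Longrightarrow> hcomp a x = 0"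
  by (rule summand_outside[OF direct_sum])

lemma hcomp_homogeneous:
  "x \<in> arrows G \<Longrightarrow> a \<in> component R x \<Longrightarrow> hcomp a y = (if y = x then a else 0)"
  by (rule summand_homogeneous[OF direct_sum])

lemma hcomp_add: "a \<in> total R \<Longrightarrow> b \<in> total R \<Longrightarrow> hcomp (a + b) x = hcomp a x + hcomp b x"
  by (rule summand_add[OF direct_sum])

lemma hcomp_sum: "(\<And>k. k \<in> K \<Longrightarrow> f k \<in> total R) \<Longrightarrow> hcomp (sum f K) x = (\<Sum>k\<in>K. hcomp (f k) x)"
  by (rule summand_sum[OF direct_sum])

lemma sum_hcomp: "a \<in> total R \<Longrightarrow> (\<Sum>x | hcomp a x \<noteq> 0. hcomp a x) = a"
  by (rule sum_summand[OF direct_sum])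

lemma finite_hcomp: "a \<in> total R \<Longrightarrow> finite {x. hcomp a x \<noteq> 0}"
  by (rule finite_summand[OF direct_sum])

text \<open>Left multiplication by degree \<open>x\<close> sends degree \<open>y\<close> to
  \<open>x y\<close>, and \<open>z \<mapsto> x^-1 z\<close> inverts this on the arrows with
  \<open>r(z) = r(x)\<close>. So exactly one component of \<open>b\<close> can contribute to degree
  \<open>z\<close>.\<close>

lemma hcomp_mult_left:
  assumes x: "x \<in> arrows G" "a \<in> component R x" and b: "b \<in> total R" and z: "z \<in> arrows G"
  shows "hcomp (a * b) z = (if gcod G z = gcod G x then a * hcomp b (gmult G (ginv G x) z) else 0)"
proof -
  let ?K = "{y. hcomp b y \<noteq> 0}"
  have K: "y \<in> arrows G" if "y \<in> ?K" for y using hcomp_outside[OF b] that by auto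
  have summands: "hcomp (a * hcomp b y) z =
      (if gcod G z = gcod G x \<and> y = gmult G (ginv G x) z then a * hcomp b y else 0)"
    if "y \<in> ?K" for y
  proof (cases "gdom G x = gcod G y")
    case True
    have y: "y \<in> arrows G" "hcomp b y \<in> component R y" using K[OF that] hcomp_component b by auto
    have "hcomp (a * hcomp b y) z = (if z = gmult G x y then a * hcomp b y else 0)"
      by (rule hcomp_homogeneous) (use x y True in \<open>auto intro: mult_closed mult_component\<close>)
    moreover have "z = gmult G x y \<longleftrightarrow> gcod G z = gcod G x \<and> y = gmult G (ginv G x) z"
      using x y z True inv_mult_cancel[of x y] mult_inv_cancel[of x z] cod_mult[of x y] by auto
    ultimately show ?thesis by simp
  next
    case False
    have "a * hcomp b y = 0"
      using x False K[OF that] hcomp_component[OF b] mult_eq_0 by blast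
    then show ?thesis by (auto simp: summand_zero[OF direct_sum])
  qed
  have "hcomp (a * b) z = hcomp (\<Sum>y\<in>?K. a * hcomp b y) z"
    using sum_hcomp[OF b] by (simp flip: sum_distrib_left)
  also have "\<dots> = (\<Sum>y\<in>?K. hcomp (a * hcomp b y) z)"
    by (rule hcomp_sum) (use x b K component_total hcomp_total mult_total in blast)
  also have "\<dots> = (\<Sum>y\<in>?K. if gcod G z = gcod G x \<and> y = gmult G (ginv G x) z
      then a * hcomp b y else 0)"
    by (rule sum.cong) (use summands in auto)
  also have "\<dots> = (if gcod G z = gcod G x then a * hcomp b (gmult G (ginv G x) z) else 0)"
    using finite_hcomp[OF b] by auto
  finally show ?thesis .
qed

text \<open>An identity as degree moves nothing; for \<open>r(z) \<noteq> e\<close> both sides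
  vanish, so no case distinction remains.\<close>

lemma hcomp_mult_identity:
  assumes e: "e \<in> identities G" "a \<in> component R e" and b: "b \<in> total R" and z: "z \<in> arrows G"
  shows "hcomp (a * b) z = a * hcomp b z"
proof (cases "gcod G z = e")
  case True
  then show ?thesis
    using hcomp_mult_left[OF identitiesD(1)[OF e(1)] e(2) b z] identitiesD[OF e(1)]
      ginv_identity[OF e(1)] cod_mult_self[OF z] by simp
next
  case False
  then show ?thesis
    using hcomp_mult_left[OF identitiesD(1)[OF e(1)] e(2) b z] identitiesD[OF e(1)]
      mult_eq_0[of e z a "hcomp b z"] hcomp_component[OF b z] e z by simp
qed

section \<open>Graded right ideals, the radical and its homogeneous elements\<close>

lemma graded_right_ideal_iff:
  "graded_right_ideal G R U \<longleftrightarrow>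
     right_ideal_of U (total R) \<and> (\<forall>a\<in>U. \<forall>x\<in>arrows G. hcomp a x \<in> U)"
  using is_direct_sum_Int_iff[OF direct_sum, of U]
  by (auto simp: graded_right_ideal_def right_ideal_of_def)

lemma gr_maximal_right_idealD:
  assumes "gr_maximal_right_ideal G R U"
  shows "U \<subseteq> total R" "additive_subgroup U" "u \<in> U \<Longrightarrow> a \<in> total R \<Longrightarrow> u * a \<in> U"
    "u \<in> U \<Longrightarrow> x \<in> arrows G \<Longrightarrow> hcomp u x \<in> U"
proof -
  have "graded_right_ideal G R U" using assms unfolding gr_maximal_right_ideal_def by blast
  then show "U \<subseteq> total R" "additive_subgroup U" "u \<in> U \<Longrightarrow> a \<in> total R \<Longrightarrow> u * a \<in> U"
    "u \<in> U \<Longrightarrow> x \<in> arrows G \<Longrightarrow> hcomp u x \<in> U"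
    unfolding graded_right_ideal_iff right_ideal_of_def by auto
qed

lemma gr_rad_total: "a \<in> gr_rad G R \<Longrightarrow> a \<in> total R"
  by (simp add: gr_rad_def)

lemma gr_radD: "a \<in> gr_rad G R \<Longrightarrow> gr_maximal_right_ideal G R U \<Longrightarrow> a \<in> U"
  by (simp add: gr_rad_def)

lemma gr_radI:
  "a \<in> total R \<Longrightarrow> (\<And>U. gr_maximal_right_ideal G R U \<Longrightarrow> a \<in> U) \<Longrightarrow> a \<in> gr_rad G R"
  by (simp add: gr_rad_def)

lemma gr_rad_subgroup: "additive_subgroup (gr_rad G R)"
  unfolding additive_subgroup_def
proof (intro conjI ballI)
  note gr_max = gr_maximal_right_idealD(2)[THEN additive_subgroupD(1)]
    gr_maximal_right_idealD(2)[THEN additive_subgroupD(2)]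
    gr_maximal_right_idealD(2)[THEN additive_subgroupD(3)]
  show "0 \<in> gr_rad G R"
    by (rule gr_radI[OF additive_subgroupD(1)[OF total_subgroup] gr_max(1)])
  show "a + b \<in> gr_rad G R" if a: "a \<in> gr_rad G R" and b: "b \<in> gr_rad G R" for a b
    by (rule gr_radI[OF additive_subgroupD(2)[OF total_subgroup]])
      (use gr_rad_total[OF a] gr_rad_total[OF b] gr_max(2) gr_radD[OF a] gr_radD[OF b] in auto)
  show "- a \<in> gr_rad G R" if a: "a \<in> gr_rad G R" for a
    by (rule gr_radI[OF additive_subgroupD(3)[OF total_subgroup]])
      (use gr_rad_total[OF a] gr_max(3) gr_radD[OF a] in auto)
qed

lemma gr_rad_mult:
  assumes "a \<in> gr_rad G R" "b \<in> total R"
  shows "a * b \<in> gr_rad G R"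
  by (rule gr_radI[OF mult_total[OF gr_rad_total[OF assms(1)] assms(2)]])
    (rule gr_maximal_right_idealD(3)[OF _ gr_radD[OF assms(1)] assms(2)])

lemma gr_rad_hcomp:
  assumes "a \<in> gr_rad G R" "x \<in> arrows G"
  shows "hcomp a x \<in> gr_rad G R"
  by (rule gr_radI[OF hcomp_total[OF gr_rad_total[OF assms(1)] assms(2)]])
    (rule gr_maximal_right_idealD(4)[OF _ gr_radD[OF assms(1)] assms(2)])

lemma gr_rad_sum: "(\<And>k. k \<in> K \<Longrightarrow> f k \<in> gr_rad G R) \<Longrightarrow> sum f K \<in> gr_rad G R"
  by (rule additive_subgroup_sum[OF gr_rad_subgroup])

lemma gr_rad_hcompI:
  assumes "a \<in> total R" "\<And>x. x \<in> arrows G \<Longrightarrow> hcomp a x \<in> gr_rad G R"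
  shows "a \<in> gr_rad G R"
proof -
  have "(\<Sum>x | hcomp a x \<noteq> 0. hcomp a x) \<in> gr_rad G R"
    by (rule gr_rad_sum) (use assms hcomp_outside in blast)
  then show ?thesis by (simp add: sum_hcomp assms(1))
qed

text \<open>The starting point for Zorn's lemma is the graded right ideal \<open>t R\<close> together with all
  \<open>1\<^sub>f R\<close> for identities \<open>f \<noteq> e\<close>.\<close>

lemma gr_maximal_right_ideal_exists:
  assumes e: "e \<in> identities G" and t: "t \<in> component R e"
    and noninv: "\<And>c. c \<in> component R e \<Longrightarrow> t * c \<noteq> unit_at R e"
  shows "\<exists>U. gr_maximal_right_ideal G R U \<and> t \<in> U \<and> unit_at R e \<notin> U"
proof -
  let ?u = "unit_at R e"
  have eA: "e \<in> arrows G" and ed: "gdom G e = e" and ec: "gcod G e = e"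
    using identitiesD[OF e] by auto
  have u: "?u \<in> component R e" and ut: "?u \<in> total R" and uu: "?u * ?u = ?u" and utt: "?u * t = t"
      and tu: "t * ?u = t" and tt: "t \<in> total R"
    using unit_component[OF e] component_total[OF eA] unit_left[OF eA] unit_right[OF eA] t ec ed
    by auto
  \<comment> \<open>Left multiplication by \<open>1_e\<close> kills the components
    \<open>v_z\<close> with \<open>r(z) \<noteq> e\<close> and keeps the others. Testing
    \<open>1_e v\<close> therefore describes the sum of \<open>t R\<close> and all
    \<open>1_f R\<close>, \<open>f \<noteq> e\<close>, without an infinite sum.\<close>
  define V0 where "V0 = {v \<in> total R. \<exists>r\<in>total R. ?u * v = t * r}"
  have V0_sub: "additive_subgroup V0"
    unfolding additive_subgroup_def
  proof (intro conjI ballI)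
    show "0 \<in> V0" using additive_subgroupD(1)[OF total_subgroup] by (force simp: V0_def)
    show "a + b \<in> V0" if ab: "a \<in> V0" "b \<in> V0" for a b
    proof -
      obtain r s where "r \<in> total R" "?u * a = t * r" "s \<in> total R" "?u * b = t * s"
        using ab by (auto simp: V0_def)
      then have "?u * (a + b) = t * (r + s)" "r + s \<in> total R"
        by (auto simp: distrib_left additive_subgroupD[OF total_subgroup])
      then show ?thesis using ab additive_subgroupD(2)[OF total_subgroup] unfolding V0_def by blast
    qed
    show "- a \<in> V0" if a: "a \<in> V0" for a
    proof -
      obtain r where "r \<in> total R" "?u * a = t * r" using a by (auto simp: V0_def)
      then have "?u * (- a) = t * (- r)" "- r \<in> total R"
        by (auto simp: additive_subgroupD[OF total_subgroup])
      then show ?thesis using a additive_subgroupD(3)[OF total_subgroup] unfolding V0_def by blast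
    qed
  qed
  have V0_mult: "v * a \<in> V0" if v: "v \<in> V0" and a: "a \<in> total R" for v a
  proof -
    obtain r where r: "r \<in> total R" "?u * v = t * r" and vt: "v \<in> total R"
      using v unfolding V0_def by blast
    then have "?u * (v * a) = t * (r * a)" by (simp flip: mult.assoc)
    then show ?thesis using r(1) vt a mult_total unfolding V0_def by blast
  qed
  have V0_hcomp: "hcomp v z \<in> V0" if v: "v \<in> V0" and z: "z \<in> arrows G" for v z
  proof -
    obtain r where r: "r \<in> total R" "?u * v = t * r" and vt: "v \<in> total R"
      using v unfolding V0_def by blast
    have "?u * hcomp v z = t * hcomp r z"
      using hcomp_mult_identity[OF e u vt z] hcomp_mult_identity[OF e t r(1) z] r(2) by simp
    then show ?thesis using hcomp_total[OF r(1) z] hcomp_total[OF vt z] by (auto simp: V0_def)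
  qed
  have V0_ideal: "graded_right_ideal G R V0"
    unfolding graded_right_ideal_iff right_ideal_of_def
    using V0_sub V0_mult V0_hcomp by (auto simp: V0_def)
  have t_V0: "t \<in> V0" unfolding V0_def using tt ut utt tu by force
  have u_V0: "?u \<notin> V0"
  proof
    assume "?u \<in> V0"
    then obtain r where "r \<in> total R" "?u * ?u = t * r" unfolding V0_def by blast
    then have r: "r \<in> total R" "?u = t * r" by (simp_all only: uu)
    \<comment> \<open>The part of degree \<open>e\<close> of \<open>t r\<close> is \<open>t\<close>
      times that of \<open>r\<close>, so a right inverse of \<open>t\<close> in \<open>R\<close>
      would yield one in \<open>R_e\<close>.\<close>
    have "?u = hcomp ?u e" using hcomp_homogeneous[OF eA u] by simp
    also have "\<dots> = t * hcomp r e" using hcomp_mult_identity[OF e t r(1) eA] r(2) by simp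
    finally show False using noninv[OF hcomp_component[OF r(1) eA]] by simp
  qed
  \<comment> \<open>Omitting the fixed element \<open>1_e\<close> survives unions of chains.
    Maximality among all proper graded right ideals is recovered below: one that contains both
    \<open>V0\<close> and \<open>1_e\<close> is the whole ring.\<close>
  define \<F> where "\<F> = {V. graded_right_ideal G R V \<and> V0 \<subseteq> V \<and> ?u \<notin> V}"
  have "\<exists>W\<in>\<F>. \<forall>V\<in>\<F>. W \<subseteq> V \<longrightarrow> V = W"
  proof (rule subset_Zorn_nonempty)
    show "\<F> \<noteq> {}" using V0_ideal u_V0 by (auto simp: \<F>_def)
    fix \<C> assume ne: "\<C> \<noteq> {}" and ch: "subset.chain \<F> \<C>"
    have mem: "graded_right_ideal G R V" "V0 \<subseteq> V" "?u \<notin> V" if "V \<in> \<C>" for V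
      using ch that by (auto simp: subset.chain_def \<F>_def)
    have sub: "additive_subgroup V" if "V \<in> \<C>" for V
      using mem(1)[OF that] by (auto simp: graded_right_ideal_iff right_ideal_of_def)
    have "additive_subgroup (\<Union>\<C>)"
      unfolding additive_subgroup_def
    proof (intro conjI ballI)
      show "0 \<in> \<Union>\<C>" using ne sub additive_subgroupD(1) by blast
      show "a + b \<in> \<Union>\<C>" if ab: "a \<in> \<Union>\<C>" "b \<in> \<Union>\<C>" for a b
      proof -
        obtain V where V: "V \<in> \<C>" "a \<in> V" using ab(1) by blast
        obtain W where W: "W \<in> \<C>" "b \<in> W" using ab(2) by blast
        have "V \<subseteq> W \<or> W \<subseteq> V" using ch V(1) W(1) unfolding subset_chain_def by blast
        then obtain Z where Z: "Z \<in> \<C>" "a \<in> Z" "b \<in> Z" using V W by blast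
        show ?thesis using additive_subgroupD(2)[OF sub[OF Z(1)] Z(2,3)] Z(1) by blast
      qed
      show "- a \<in> \<Union>\<C>" if a: "a \<in> \<Union>\<C>" for a
      proof -
        obtain V where V: "V \<in> \<C>" "a \<in> V" using a by blast
        show ?thesis using additive_subgroupD(3)[OF sub[OF V(1)] V(2)] V(1) by blast
      qed
    qed
    moreover have "\<Union>\<C> \<subseteq> total R"
      using mem(1) unfolding graded_right_ideal_iff right_ideal_of_def by blast
    moreover have "v * a \<in> \<Union>\<C>" if va: "v \<in> \<Union>\<C>" "a \<in> total R" for v a
      using mem(1) va unfolding graded_right_ideal_iff right_ideal_of_def by blast
    moreover have "hcomp v x \<in> \<Union>\<C>" if vx: "v \<in> \<Union>\<C>" "x \<in> arrows G" for v x
      using mem(1) vx unfolding graded_right_ideal_iff by blast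
    ultimately have "graded_right_ideal G R (\<Union>\<C>)"
      unfolding graded_right_ideal_iff right_ideal_of_def by blast
    then show "\<Union>\<C> \<in> \<F>" using ne mem unfolding \<F>_def by blast
  qed
  then obtain W where W: "W \<in> \<F>" and Wmax: "\<And>V. V \<in> \<F> \<Longrightarrow> W \<subseteq> V \<Longrightarrow> V = W" by blast
  have Wi: "graded_right_ideal G R W" "V0 \<subseteq> W" "?u \<notin> W" using W by (auto simp: \<F>_def)
  have "V = W" if V: "graded_right_ideal G R V" "V \<noteq> total R" "W \<subseteq> V" for V
  proof -
    have Vi: "V \<subseteq> total R" "additive_subgroup V" "\<And>v a. v \<in> V \<Longrightarrow> a \<in> total R \<Longrightarrow> v * a \<in> V"
      using V(1) by (auto simp: graded_right_ideal_iff right_ideal_of_def)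
    have "?u \<notin> V"
    proof
      assume uV: "?u \<in> V"
      have "v \<in> V" if v: "v \<in> total R" for v
      proof -
        \<comment> \<open>\<open>v - 1_e v\<close> is killed by \<open>1_e\<close>, so it lies in
          \<open>V0\<close> with witness \<open>r = 0\<close>.\<close>
        have "?u * (v - ?u * v) = t * 0" "v - ?u * v \<in> total R"
          using uu v ut additive_subgroupD(4)[OF total_subgroup] mult_total
          by (auto simp: right_diff_distrib mult.assoc[symmetric])
        then have "v - ?u * v \<in> V0"
          using additive_subgroupD(1)[OF total_subgroup] unfolding V0_def by blast
        then have "v - ?u * v + ?u * v \<in> V"
          using Wi(2) V(3) Vi(3)[OF uV v] additive_subgroupD(2)[OF Vi(2)] by blast
        then show ?thesis by simp
      qed
      then show False using V(2) Vi(1) by blast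
    qed
    then have "V \<in> \<F>" using V Wi(2) by (auto simp: \<F>_def)
    then show ?thesis using Wmax V(3) by blast
  qed
  then have "gr_maximal_right_ideal G R W"
    using Wi(1,3) ut by (auto simp: gr_maximal_right_ideal_def)
  then show ?thesis using Wi t_V0 by blast
qed

text \<open>If \<open>1_e - a b\<close> had no right inverse in \<open>R_e\<close>, some gr-maximal
  ideal would contain it together with \<open>a b\<close>, but not \<open>1_e\<close>. Conversely,
  if a gr-maximal \<open>U\<close> misses \<open>a\<close>, then \<open>U + a R\<close> is
  everything, and \<open>1_e = v + a r\<close> puts some \<open>1_e - a b\<close> into
  \<open>U\<close>; its right inverse puts \<open>1_e\<close>, and then \<open>a = 1_e a\<close>,
  into \<open>U\<close>. Since \<open>1_e c = c\<close>, the equation can be written as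
  \<open>c - a b c = 1_e\<close>, which for matrices is convenient to compare at a single
  entry.\<close>

theorem homogeneous_gr_rad_iff:
  assumes x: "x \<in> arrows G" and a: "a \<in> component R x"
  shows "a \<in> gr_rad G R \<longleftrightarrow>
    (\<forall>b\<in>component R (ginv G x). \<exists>c\<in>component R (gcod G x). c - a * b * c = unit_at R (gcod G x))"
proof -
  let ?e = "gcod G x" and ?u = "unit_at R (gcod G x)"
  have e: "?e \<in> identities G" and eA: "?e \<in> arrows G" and ec: "gcod G ?e = ?e"
    using x by (auto simp: cod_identity cod_closed cod_cod)
  have u: "?u \<in> component R ?e" using unit_component[OF e] .
  have ut: "?u \<in> total R" and at: "a \<in> total R" using u a eA x component_total by auto
  have ab: "a * b \<in> component R ?e" if "b \<in> component R (ginv G x)" for b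
    using mult_component[OF x inv_closed[OF x] a that] cod_inv[OF x] by (simp add: mult_inv)
  show ?thesis
  proof (intro iffI ballI)
    fix b assume rad: "a \<in> gr_rad G R" and b: "b \<in> component R (ginv G x)"
    let ?t = "?u - a * b"
    have t: "?t \<in> component R ?e"
      using additive_subgroupD(4)[OF component_subgroup[OF eA] u ab[OF b]] .
    have "\<exists>c\<in>component R ?e. ?t * c = ?u"
    proof (rule ccontr)
      assume "\<not> (\<exists>c\<in>component R ?e. ?t * c = ?u)"
      with gr_maximal_right_ideal_exists[OF e t] obtain U
        where U: "gr_maximal_right_ideal G R U" "?t \<in> U" "?u \<notin> U" by blast
      have "additive_subgroup U" and "a * b \<in> U"
        using gr_maximal_right_idealD[OF U(1)] component_total[OF inv_closed[OF x] b]
          gr_radD[OF rad U(1)] by auto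
      from additive_subgroupD(2)[OF this(1) U(2) this(2)] U(3) show False by simp
    qed
    then obtain c where "c \<in> component R ?e" "?t * c = ?u" by blast
    moreover from this have "?u * c = c" using unit_left[OF eA] ec by simp
    ultimately show "\<exists>c\<in>component R ?e. c - a * b * c = ?u"
      by (auto simp: left_diff_distrib)
  next
    assume inv: "\<forall>b\<in>component R (ginv G x). \<exists>c\<in>component R ?e. c - a * b * c = ?u"
    show "a \<in> gr_rad G R"
    proof (rule ccontr)
      assume "a \<notin> gr_rad G R"
      then obtain U where U: "gr_maximal_right_ideal G R U" and aU: "a \<notin> U"
        using at by (auto simp: gr_rad_def)
      have Ui: "U \<subseteq> total R" "additive_subgroup U" "\<And>v r. v \<in> U \<Longrightarrow> r \<in> total R \<Longrightarrow> v * r \<in> U"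
          "\<And>v z. v \<in> U \<Longrightarrow> z \<in> arrows G \<Longrightarrow> hcomp v z \<in> U"
        using gr_maximal_right_idealD[OF U] by auto
      \<comment> \<open>This is \<open>U + a R\<close>; it is graded because \<open>a\<close> is
        homogeneous.\<close>
      define V where "V = {v + a * r | v r. v \<in> U \<and> r \<in> total R}"
      have Vt: "V \<subseteq> total R"
        using Ui(1) at mult_total additive_subgroupD(2)[OF total_subgroup] unfolding V_def by blast
      have VI: "v + a * r \<in> V" if "v \<in> U" "r \<in> total R" for v r
        using that unfolding V_def by blast
      have Vsub: "additive_subgroup V"
        unfolding additive_subgroup_def
      proof (intro conjI ballI)
        show "0 \<in> V"
          using VI[of 0 0] additive_subgroupD(1)[OF Ui(2)] additive_subgroupD(1)[OF total_subgroup]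
          by simp
        show "p + q \<in> V" if pq: "p \<in> V" "q \<in> V" for p q
        proof -
          obtain v r w s where vw: "v \<in> U" "r \<in> total R" "w \<in> U" "s \<in> total R"
            "p = v + a * r" "q = w + a * s"
            using pq unfolding V_def by blast
          then have "p + q = v + w + a * (r + s)" by (simp add: distrib_left)
          moreover have "v + w \<in> U" "r + s \<in> total R"
            using vw additive_subgroupD(2)[OF Ui(2)] additive_subgroupD(2)[OF total_subgroup] by auto
          ultimately show ?thesis using VI by metis
        qed
        show "- p \<in> V" if p: "p \<in> V" for p
        proof -
          obtain v r where vr: "v \<in> U" "r \<in> total R" "p = v + a * r"
            using p unfolding V_def by blast
          then have "- p = - v + a * (- r)" by simp
          then show ?thesis
            using VI[of "- v" "- r"] vr additive_subgroupD(3)[OF Ui(2)]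
              additive_subgroupD(3)[OF total_subgroup] by simp
        qed
      qed
      have Vmult: "p * s \<in> V" if p: "p \<in> V" and s: "s \<in> total R" for p s
      proof -
        obtain v r where vr: "v \<in> U" "r \<in> total R" "p = v + a * r"
          using p unfolding V_def by blast
        then have "p * s = v * s + a * (r * s)" by (simp add: distrib_right mult.assoc)
        then show ?thesis using VI[of "v * s" "r * s"] vr s Ui(3) mult_total by simp
      qed
      have Vh: "hcomp p z \<in> V" if p: "p \<in> V" and z: "z \<in> arrows G" for p z
      proof -
        obtain v r where vr: "v \<in> U" "r \<in> total R" "p = v + a * r"
          using p unfolding V_def by blast
        have eq: "hcomp p z = hcomp v z + hcomp (a * r) z"
          using vr Ui(1) at mult_total hcomp_add by blast
        show ?thesis
        proof (cases "gcod G z = gcod G x")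
          case True
          then have "gmult G (ginv G x) z \<in> arrows G"
            using x z by (simp add: mult_closed inv_closed dom_inv)
          then show ?thesis
            using eq True hcomp_mult_left[OF x a vr(2) z] VI Ui(4)[OF vr(1) z] hcomp_total[OF vr(2)]
            by simp
        next
          case False
          then show ?thesis
            using eq hcomp_mult_left[OF x a vr(2) z] VI[of "hcomp v z" 0] Ui(4)[OF vr(1) z]
              additive_subgroupD(1)[OF total_subgroup] by simp
        qed
      qed
      have Vid: "graded_right_ideal G R V"
        unfolding graded_right_ideal_iff right_ideal_of_def using Vt Vsub Vmult Vh by blast
      have UV: "U \<subseteq> V" using VI[of _ 0] additive_subgroupD(1)[OF total_subgroup] by auto
      have "a \<in> V"
      proof -
        \<comment> \<open>In the absence of a global identity, \<open>a \<in> a R\<close> holds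
          because \<open>a = a 1_d(x)\<close>.\<close>
        have "unit_at R (gdom G x) \<in> total R"
          using x component_total dom_closed dom_identity unit_component by blast
        from VI[OF additive_subgroupD(1)[OF Ui(2)] this] show ?thesis
          using unit_right[OF x a] by simp
      qed
      then have "V = total R"
        using U Vid UV aU unfolding gr_maximal_right_ideal_def by blast
      then obtain v r where vr: "v \<in> U" "r \<in> total R" "?u = v + a * r"
        using ut unfolding V_def by blast
      \<comment> \<open>Only the part of \<open>r\<close> of degree \<open>x^-1\<close> contributes
        to degree \<open>r(x)\<close> of \<open>a r\<close>. Comparing parts of this degree in
        \<open>?u = v + a * r\<close> gives \<open>?u - a * b \<in> U\<close>, as \<open>U\<close>
        is graded.\<close>
      define b where "b = hcomp r (ginv G x)"
      have b: "b \<in> component R (ginv G x)"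
        using hcomp_component[OF vr(2) inv_closed[OF x]] by (simp add: b_def)
      have "gmult G (ginv G x) (gcod G x) = ginv G x"
        using mult_dom[OF inv_closed[OF x]] dom_inv[OF x] by simp
      then have "?u = hcomp v ?e + a * b"
        using hcomp_homogeneous[OF eA u, of ?e] hcomp_mult_left[OF x a vr(2) eA] ec vr
          hcomp_add[of v "a * r" ?e] Ui(1) at mult_total[OF at vr(2)]
        by (auto simp: b_def)
      then have tU: "?u - a * b \<in> U" using Ui(4)[OF vr(1) eA] by (metis add_diff_cancel_right')
      obtain c where c: "c \<in> component R ?e" "c - a * b * c = ?u" using inv b by blast
      have "?u * c = c" using unit_left[OF eA c(1)] ec by simp
      then have "(?u - a * b) * c = ?u" using c(2) by (simp add: left_diff_distrib)
      then have "?u \<in> U" using Ui(3)[OF tU] component_total[OF eA c(1)] by metis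
      from Ui(3)[OF this at] aU show False using unit_left[OF x a] by simp
    qed
  qed
qed

end

section \<open>Entries of matrices\<close>

lemma entry_zero: "entry 0 i j = 0"
  by (simp add: zero_fin_matrix.rep_eq)

lemma entry_add: "entry (A + B) i j = entry A i j + entry B i j"
  by (simp add: plus_fin_matrix.rep_eq)

lemma entry_minus: "entry (- A) i j = - entry A i j"
  by (simp add: uminus_fin_matrix.rep_eq)

lemma entry_diff: "entry (A - B) i j = entry A i j - entry B i j"
  by (simp add: minus_fin_matrix.rep_eq)

lemma entry_sum: "entry (sum f K) i j = (\<Sum>k\<in>K. entry (f k) i j)"
  by (induction K rule: infinite_finite_induct) (simp_all add: entry_zero entry_add)

lemma finite_entry: "finite {(i, j). entry A i j \<noteq> 0}"
  using entry[of A] by simp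

lemma entry_Abs: "finite {(i, j). f i j \<noteq> 0} \<Longrightarrow> entry (Abs_fin_matrix f) = f"
  by (simp add: Abs_fin_matrix_inverse)

definition single :: "'i \<Rightarrow> 'i \<Rightarrow> 'a::zero \<Rightarrow> ('i, 'a) fin_matrix" where
  "single i j a = Abs_fin_matrix (\<lambda>k l. if k = i \<and> l = j then a else 0)"

lemma entry_single: "entry (single i j a) k l = (if k = i \<and> l = j then a else 0)"
proof -
  have "{(k, l). (if k = i \<and> l = j then a else 0) \<noteq> 0} \<subseteq> {(i, j)}" by auto
  then have "finite {(k, l). (if k = i \<and> l = j then a else 0) \<noteq> 0}"
    by (rule finite_subset) simp
  then show ?thesis by (simp add: single_def entry_Abs)
qed

lemma entry_single_mult: "entry (single i j a * B) k l = (if k = i then a * entry B j l else 0)"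
  by (subst entry_times_superset[where K = "{j}"]) (auto simp: entry_single)

lemma entry_mult_single:
  "entry (A * single i j a) k l = (if l = j then entry A k i * a else 0)"
proof -
  \<comment> \<open>The index \<open>i\<close> is inserted because \<open>entry A k i\<close> may be
    zero, while the sum is collapsed to its term at \<open>i\<close>.\<close>
  let ?K = "insert i {m. entry A k m \<noteq> 0}"
  have "entry (A * single i j a) k l = (\<Sum>m\<in>?K. entry A k m * entry (single i j a) m l)"
    by (rule entry_times_superset) (auto simp: finite_row)
  also have "\<dots> = (\<Sum>m\<in>?K. if m = i then (if l = j then entry A k i * a else 0) else 0)"
    by (rule sum.cong) (auto simp: entry_single)
  also have "\<dots> = (if l = j then entry A k i * a else 0)"
    by (simp add: finite_row)
  finally show ?thesis .
qed

definition row_matrix :: "'i \<Rightarrow> ('i, 'a::zero) fin_matrix \<Rightarrow> ('i, 'a) fin_matrix" where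
  "row_matrix i A = Abs_fin_matrix (\<lambda>k l. if k = i then entry A k l else 0)"

lemma entry_row_matrix: "entry (row_matrix i A) k l = (if k = i then entry A k l else 0)"
proof -
  have "finite {(k, l). (if k = i then entry A k l else 0) \<noteq> 0}"
    by (rule finite_subset[OF _ finite_entry[of A]]) (auto split: if_splits)
  then show ?thesis by (simp add: row_matrix_def entry_Abs)
qed

lemma sum_row_matrix:
  assumes "finite K" "\<And>k l. entry A k l \<noteq> 0 \<Longrightarrow> k \<in> K"
  shows "(\<Sum>k\<in>K. row_matrix k A) = A"
proof (rule fin_matrix_eqI)
  fix i j
  have "entry (\<Sum>k\<in>K. row_matrix k A) i j = (\<Sum>k\<in>K. if k = i then entry A i j else 0)"
    unfolding entry_sum by (rule sum.cong) (auto simp: entry_row_matrix)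
  also have "\<dots> = entry A i j" using assms by auto
  finally show "entry (\<Sum>k\<in>K. row_matrix k A) i j = entry A i j" .
qed

section \<open>Graded matrix rings\<close>

context groupoid
begin

section \<open>Degrees of matrix entries: the shifts \<open>s x t^-1\<close>\<close>

definition shift :: "'g \<Rightarrow> 'g \<Rightarrow> 'g \<Rightarrow> 'g" where
  "shift s x t = gmult G (gmult G s x) (ginv G t)"

context
  fixes s x t
  assumes arr: "s \<in> arrows G" "x \<in> arrows G" "t \<in> arrows G"
    and ends: "gdom G s = gcod G x" "gdom G x = gdom G t"
begin

lemma shift_arrow: "shift s x t \<in> arrows G"
  using arr ends by (simp add: shift_def mult_closed inv_closed dom_mult cod_inv)

lemma cod_shift: "gcod G (shift s x t) = gcod G s"
  using arr ends by (simp add: shift_def mult_closed inv_closed dom_mult cod_inv cod_mult)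

lemma dom_shift: "gdom G (shift s x t) = gcod G t"
  using arr ends by (simp add: shift_def mult_closed inv_closed dom_mult cod_inv dom_inv)

text \<open>For known \<open>s\<close> and \<open>t\<close> the degree \<open>x\<close> is recovered
  as \<open>s^-1 y t\<close>. This yields \<open>shifts_inj\<close>; the reverse composite
  \<open>shift_unshift\<close> yields \<open>shifts_surj\<close>.\<close>

lemma unshift: "gmult G (ginv G s) (gmult G (shift s x t) t) = x"
  using arr ends mult_inv_cancel_right[of "gmult G s x" t] inv_mult_cancel[of s x]
  by (simp add: shift_def mult_closed dom_mult)

end

lemma shift_unshift:
  assumes "s \<in> arrows G" "y \<in> arrows G" "t \<in> arrows G" "gcod G s = gcod G y" "gcod G t = gdom G y"
  shows "shift s (gmult G (ginv G s) (gmult G y t)) t = y"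
proof -
  have yt: "gmult G y t \<in> arrows G" "gcod G (gmult G y t) = gcod G y"
    using assms by (simp_all add: mult_closed cod_mult)
  have "shift s (gmult G (ginv G s) (gmult G y t)) t = gmult G (gmult G y t) (ginv G t)"
    unfolding shift_def using mult_inv_cancel[OF assms(1) yt(1)] yt(2) assms(4) by simp
  also have "\<dots> = gmult G y (gcod G t)"
    using mult_assoc[of y t "ginv G t"] assms by (simp add: inv_closed cod_inv mult_inv)
  also have "\<dots> = y" using assms by (simp add: mult_dom)
  finally show ?thesis .
qed

text \<open>The inner \<open>t^-1 t\<close> cancels. This is why a product of entries at
  \<open>(i, k)\<close> and \<open>(k, j)\<close> has the degree prescribed at
  \<open>(i, j)\<close>.\<close>

lemma shift_mult:
  assumes "s \<in> arrows G" "x \<in> arrows G" "t \<in> arrows G" "gdom G s = gcod G x" "gdom G x = gdom G t"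
    and "y \<in> arrows G" "r \<in> arrows G" "gdom G t = gcod G y" "gdom G y = gdom G r"
  shows "gmult G (shift s x t) (shift t y r) = shift s (gmult G x y) r"
proof -
  let ?m = "gmult G" and ?i = "ginv G"
  note closure = assms mult_closed dom_mult cod_mult inv_closed dom_inv cod_inv
  have yr: "?m y (?i r) \<in> arrows G" "gcod G (?m y (?i r)) = gcod G y"
    using closure by simp_all
  have "?m (shift s x t) (shift t y r) = ?m (?m (?m s x) (?i t)) (?m t (?m y (?i r)))"
    unfolding shift_def using mult_assoc[of t y "?i r"] closure by simp
  also have "\<dots> = ?m (?m s x) (?m (?i t) (?m t (?m y (?i r))))"
    using mult_assoc[of "?m s x" "?i t" "?m t (?m y (?i r))"] closure by simp
  also have "\<dots> = ?m (?m s x) (?m y (?i r))"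
    using inv_mult_cancel[OF assms(3) yr(1)] yr(2) assms(8) by simp
  also have "\<dots> = ?m (?m (?m s x) y) (?i r)"
    using mult_assoc[of "?m s x" y "?i r"] closure by simp
  also have "\<dots> = ?m (?m s (?m x y)) (?i r)"
    using mult_assoc[of s x y] closure by simp
  finally show ?thesis by (simp add: shift_def)
qed

lemma shift_identity:
  assumes "s \<in> arrows G"
  shows "shift s (gdom G s) s = gcod G s"
  using assms by (simp add: shift_def mult_dom mult_inv)

end

locale matricial_ring = object_unital_ring G R
  for G :: "'g groupoid_data" and R :: "('g, 'a::ring) graded_data" +
  fixes I :: "'i set" and \<Sigma> :: "'i \<Rightarrow> 'g set"
  assumes matricial: "fully_matricial G R I \<Sigma>"
begin

abbreviation "MR \<equiv> matrix_graded G R I \<Sigma>"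

lemma Sigma_arrows: "i \<in> I \<Longrightarrow> s \<in> \<Sigma> i \<Longrightarrow> s \<in> arrows G"
  using matricial unfolding fully_matricial_def by blast

lemma dom_inj: "i \<in> I \<Longrightarrow> s \<in> \<Sigma> i \<Longrightarrow> t \<in> \<Sigma> i \<Longrightarrow> gdom G s = gdom G t \<Longrightarrow> s = t"
  using matricial unfolding fully_matricial_def inj_on_def by blast

lemma cod_inj: "i \<in> I \<Longrightarrow> s \<in> \<Sigma> i \<Longrightarrow> t \<in> \<Sigma> i \<Longrightarrow> gcod G s = gcod G t \<Longrightarrow> s = t"
  using matricial unfolding fully_matricial_def bij_betw_def inj_on_def by blast

lemma cod_surj:
  assumes "i \<in> I" "e \<in> nonzero_identities G R"
  obtains s where "s \<in> \<Sigma> i" "gcod G s = e"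
proof -
  have "gcod G ` \<Sigma> i = nonzero_identities G R"
    using matricial assms(1) unfolding fully_matricial_def bij_betw_def by blast
  with assms(2) have "e \<in> gcod G ` \<Sigma> i" by simp
  then show thesis by (elim imageE) (rule that, auto)
qed

lemma finite_indices: "e \<in> identities G \<Longrightarrow> finite {i \<in> I. \<exists>s\<in>\<Sigma> i. gdom G s = e}"
  using matricial by (simp add: fully_matricial_def)

text \<open>\<open>shifts i j x y\<close> says that \<open>y\<close> is the element of \<open>\<Sigma>\<^sub>i x \<Sigma>\<^sub>j\<^sup>-\<^sup>1\<close>.\<close>

definition shifts :: "'i \<Rightarrow> 'i \<Rightarrow> 'g \<Rightarrow> 'g \<Rightarrow> bool" where
  "shifts i j x y \<longleftrightarrow>
     (\<exists>s\<in>\<Sigma> i. \<exists>t\<in>\<Sigma> j. gdom G s = gcod G x \<and> gdom G x = gdom G t \<and> y = shift s x t)"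

lemma shiftsE:
  assumes "shifts i j x y" "i \<in> I" "j \<in> I" "x \<in> arrows G"
  obtains s t where "s \<in> \<Sigma> i" "t \<in> \<Sigma> j" "s \<in> arrows G" "t \<in> arrows G"
    "gdom G s = gcod G x" "gdom G x = gdom G t" "y = shift s x t"
    "y \<in> arrows G" "gcod G y = gcod G s" "gdom G y = gcod G t"
proof -
  obtain s t where st: "s \<in> \<Sigma> i" "t \<in> \<Sigma> j" "gdom G s = gcod G x" "gdom G x = gdom G t"
    and y: "y = shift s x t"
    using assms(1) unfolding shifts_def by blast
  have s: "s \<in> arrows G" and t: "t \<in> arrows G" using Sigma_arrows st(1,2) assms(2,3) by auto
  note shift = shift_arrow[OF s assms(4) t st(3,4)] cod_shift[OF s assms(4) t st(3,4)]
    dom_shift[OF s assms(4) t st(3,4)]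
  show thesis by (rule that[OF st(1,2) s t st(3,4) y]) (simp_all only: y shift)
qed

lemma shifts_arrow: "shifts i j x y \<Longrightarrow> i \<in> I \<Longrightarrow> j \<in> I \<Longrightarrow> x \<in> arrows G \<Longrightarrow> y \<in> arrows G"
  by (erule shiftsE)

text \<open>Here \<open>x\<close> determines \<open>s\<close> and \<open>t\<close>: their domains
  are \<open>r(x)\<close> and \<open>d(x)\<close>, and \<open>d\<close> is injective on
  \<open>\<Sigma> i\<close> and on \<open>\<Sigma> j\<close>.\<close>

lemma shifts_unique:
  assumes "shifts i j x y" "shifts i j x z" "i \<in> I" "j \<in> I"
  shows "y = z"
proof -
  obtain s t where st: "s \<in> \<Sigma> i" "t \<in> \<Sigma> j" "gdom G s = gcod G x" "gdom G x = gdom G t"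
    "y = shift s x t"
    using assms(1) unfolding shifts_def by blast
  obtain s' t' where st': "s' \<in> \<Sigma> i" "t' \<in> \<Sigma> j" "gdom G s' = gcod G x" "gdom G x = gdom G t'"
    "z = shift s' x t'"
    using assms(2) unfolding shifts_def by blast
  have "s' = s" using dom_inj[OF assms(3) st'(1) st(1)] st st' by simp
  moreover have "t' = t" using dom_inj[OF assms(4) st'(2) st(2)] st(4) st'(4) by simp
  ultimately show ?thesis using st st' by simp
qed

text \<open>Here the common value \<open>z\<close> determines \<open>s\<close> and \<open>t\<close>:
  \<open>r(s) = r(z)\<close>, \<open>r(t) = d(z)\<close>, and \<open>r\<close> is injective on
  \<open>\<Sigma> i\<close> and on \<open>\<Sigma> j\<close>. Then \<open>unshift\<close>
  applies.\<close>

lemma shifts_inj: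
  assumes "shifts i j x z" "shifts i j y z" "i \<in> I" "j \<in> I" "x \<in> arrows G" "y \<in> arrows G"
  shows "x = y"
proof -
  obtain s t where st: "s \<in> \<Sigma> i" "t \<in> \<Sigma> j" "s \<in> arrows G" "t \<in> arrows G"
    "gdom G s = gcod G x" "gdom G x = gdom G t" "z = shift s x t"
    "gcod G z = gcod G s" "gdom G z = gcod G t"
    by (rule shiftsE[OF assms(1,3-5)])
  obtain s' t' where st': "s' \<in> \<Sigma> i" "t' \<in> \<Sigma> j" "s' \<in> arrows G" "t' \<in> arrows G"
    "gdom G s' = gcod G y" "gdom G y = gdom G t'" "z = shift s' y t'"
    "gcod G z = gcod G s'" "gdom G z = gcod G t'"
    by (rule shiftsE[OF assms(2-4,6)])
  have s: "s' = s" using cod_inj[OF assms(3) st'(1) st(1)] st(8) st'(8) by simp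
  have t: "t' = t" using cod_inj[OF assms(4) st'(2) st(2)] st(9) st'(9) by simp
  show ?thesis
    using unshift[OF st(3) assms(5) st(4-6)] unshift[OF st'(3) assms(6) st'(4-6)] st(7) st'(7)
    unfolding s t by metis
qed

text \<open>Surjectivity of \<open>r\<close> provides \<open>s\<close> and \<open>t\<close> with
  \<open>r(s) = r(y)\<close> and \<open>r(t) = d(y)\<close>, and \<open>x = s^-1 y t\<close> solves
  the equation. So no nonzero part of an entry is missed by the grading of matrices.\<close>

lemma shifts_surj:
  assumes "y \<in> arrows G" "gcod G y \<in> nonzero_identities G R" "gdom G y \<in> nonzero_identities G R"
    and "i \<in> I" "j \<in> I"
  shows "\<exists>x\<in>arrows G. shifts i j x y"
proof -
  obtain s where s: "s \<in> \<Sigma> i" "gcod G s = gcod G y" using cod_surj[OF assms(4,2)] .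
  obtain t where t: "t \<in> \<Sigma> j" "gcod G t = gdom G y" using cod_surj[OF assms(5,3)] .
  have arr: "s \<in> arrows G" "t \<in> arrows G" using s t Sigma_arrows assms by auto
  let ?x = "gmult G (ginv G s) (gmult G y t)"
  have "?x \<in> arrows G" "gdom G s = gcod G ?x" "gdom G ?x = gdom G t"
    using s t arr assms(1)
    by (simp_all add: mult_closed inv_closed cod_mult dom_mult dom_inv cod_inv)
  moreover have "y = shift s ?x t" using shift_unshift[of s y t] arr assms s t by simp
  ultimately show ?thesis using s t unfolding shifts_def by blast
qed

lemma shifts_identity:
  assumes "i \<in> I" "s \<in> \<Sigma> i"
  shows "shifts i i (gdom G s) (gcod G s)"
proof -
  have "s \<in> arrows G" using assms Sigma_arrows by blast
  then show ?thesis
    unfolding shifts_def using assms(2) shift_identity by (metis cod_dom dom_dom)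
qed

text \<open>The two elements of \<open>\<Sigma> k\<close> involved have the same range, by
  \<open>d(y) = r(y')\<close>, and so coincide. Hence composability of entry degrees forces
  composability of the matrix degrees.\<close>

lemma shifts_mult:
  assumes "shifts i k x y" "shifts k j x' y'" "i \<in> I" "j \<in> I" "k \<in> I" "x \<in> arrows G" "x' \<in> arrows G"
    and "gdom G y = gcod G y'"
  shows "gdom G x = gcod G x'" "shifts i j (gmult G x x') (gmult G y y')"
proof -
  obtain s t where st: "s \<in> \<Sigma> i" "t \<in> \<Sigma> k" "s \<in> arrows G" "t \<in> arrows G"
    "gdom G s = gcod G x" "gdom G x = gdom G t" "y = shift s x t" "gdom G y = gcod G t"
    by (rule shiftsE[OF assms(1,3,5,6)])
  obtain t' r where tr: "t' \<in> \<Sigma> k" "r \<in> \<Sigma> j" "t' \<in> arrows G" "r \<in> arrows G"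
    "gdom G t' = gcod G x'" "gdom G x' = gdom G r" "y' = shift t' x' r" "gcod G y' = gcod G t'"
    by (rule shiftsE[OF assms(2,5,4,7)])
  have t: "t' = t" using cod_inj[OF assms(5) tr(1) st(2)] st(8) tr(8) assms(8) by simp
  show d: "gdom G x = gcod G x'" using st(6) tr(5) t by simp
  have "gmult G y y' = shift s (gmult G x x') r"
    using shift_mult[OF st(3) assms(6) st(4-6) assms(7) tr(4)] st tr t by simp
  moreover have "gdom G s = gcod G (gmult G x x')" "gdom G (gmult G x x') = gdom G r"
    using st tr d assms by (simp_all add: cod_mult dom_mult)
  ultimately show "shifts i j (gmult G x x') (gmult G y y')"
    using st(1) tr(2) unfolding shifts_def by blast
qed

text \<open>The product of \<open>s x t^-1\<close> and \<open>t x^-1 s^-1\<close> is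
  \<open>r(s)\<close>. The lemma allows an element of degree \<open>y^-1\<close> to be placed at
  position \<open>(j, i)\<close> of a matrix of degree \<open>x^-1\<close>.\<close>

lemma shifts_inverse:
  assumes "shifts i j x y" "i \<in> I" "j \<in> I" "x \<in> arrows G"
  shows "shifts j i (ginv G x) (ginv G y)"
proof -
  obtain s t where st: "s \<in> \<Sigma> i" "t \<in> \<Sigma> j" "s \<in> arrows G" "t \<in> arrows G"
    "gdom G s = gcod G x" "gdom G x = gdom G t" "y = shift s x t" "y \<in> arrows G"
    "gcod G y = gcod G s" "gdom G y = gcod G t"
    by (rule shiftsE[OF assms])
  have inv: "ginv G x \<in> arrows G" "gcod G (ginv G x) = gdom G x" "gdom G (ginv G x) = gcod G x"
    using assms(4) by (simp_all add: inv_closed cod_inv dom_inv)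
  let ?z = "shift t (ginv G x) s"
  have z: "?z \<in> arrows G" "gcod G ?z = gcod G t"
    using shift_arrow[of t "ginv G x" s] cod_shift[of t "ginv G x" s] st inv by auto
  have "gmult G y ?z = shift s (gmult G x (ginv G x)) s"
  proof -
    have "gdom G t = gcod G (ginv G x)" "gdom G (ginv G x) = gdom G s"
      by (simp_all only: inv st(5,6))
    from shift_mult[OF st(3) assms(4) st(4-6) inv(1) st(3) this] show ?thesis unfolding st(7) .
  qed
  also have "\<dots> = gcod G y" unfolding mult_inv st(5)[symmetric] st(9) by (rule shift_identity[OF st(3)])
  finally have "?z = ginv G y" using inverse_unique[of y ?z] st(8,10) z by simp
  then show ?thesis using st inv unfolding shifts_def by metis
qed

section \<open>Homogeneous components of the matrix ring in terms of shifts\<close>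

lemma set_product_eq:
  assumes "i \<in> I" "j \<in> I" "x \<in> arrows G"
  shows "set_gmult G (set_gmult G (\<Sigma> i) {x}) (set_ginv G (\<Sigma> j)) = {y. shifts i j x y}"
proof -
  have "gdom G (gmult G s x) = gcod G (ginv G t) \<longleftrightarrow> gdom G x = gdom G t"
    if "s \<in> \<Sigma> i" "t \<in> \<Sigma> j" "gdom G s = gcod G x" for s t
    using that assms Sigma_arrows by (simp add: dom_mult cod_inv)
  then show ?thesis
    unfolding set_gmult_def set_ginv_def shifts_def shift_def by blast
qed

text \<open>The disjunct \<open>a = 0\<close> covers the empty product set and is harmless
  otherwise, since \<open>0\<close> lies in every component. From here on \<open>the_elem\<close>
  does not appear.\<close>

lemma component_of_set_iff:
  assumes "i \<in> I" "j \<in> I" "x \<in> arrows G"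
  shows "a \<in> component_of_set R (set_gmult G (set_gmult G (\<Sigma> i) {x}) (set_ginv G (\<Sigma> j))) \<longleftrightarrow>
    a = 0 \<or> (\<exists>y. shifts i j x y \<and> a \<in> component R y)"
proof (cases "\<exists>y. shifts i j x y")
  case True
  then obtain y where y: "shifts i j x y" by blast
  then have shifts_eq: "shifts i j x z \<longleftrightarrow> z = y" for z using shifts_unique assms by blast
  then have eq: "{y. shifts i j x y} = {y}" by blast
  have "0 \<in> component R y"
    using additive_subgroupD(1)[OF component_subgroup] shifts_arrow[OF y] assms by blast
  then show ?thesis
    unfolding set_product_eq[OF assms] by (auto simp: component_of_set_def eq shifts_eq)
next
  case False
  then show ?thesis
    unfolding set_product_eq[OF assms] by (simp add: component_of_set_def)
qed

lemma total_MR_iff: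
  "A \<in> total MR \<longleftrightarrow> (\<forall>i\<in>I. \<forall>j\<in>I. entry A i j \<in> total R) \<and>
     (\<forall>i j. i \<notin> I \<or> j \<notin> I \<longrightarrow> entry A i j = 0)"
  by (simp add: matrix_graded_def matrices_def)

lemma entry_total: "A \<in> total MR \<Longrightarrow> entry A i j \<in> total R"
  using additive_subgroupD(1)[OF total_subgroup] unfolding total_MR_iff by metis

lemma component_MR_iff:
  assumes "x \<in> arrows G"
  shows "A \<in> component MR x \<longleftrightarrow> (\<forall>i j. i \<notin> I \<or> j \<notin> I \<longrightarrow> entry A i j = 0) \<and>
    (\<forall>i\<in>I. \<forall>j\<in>I. entry A i j = 0 \<or> (\<exists>y. shifts i j x y \<and> entry A i j \<in> component R y))"
proof -
  have "entry A i j \<in> total R"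
    if "i \<in> I" "j \<in> I" "entry A i j = 0 \<or> (\<exists>y. shifts i j x y \<and> entry A i j \<in> component R y)" for i j
    using that additive_subgroupD(1)[OF total_subgroup] component_total shifts_arrow[OF _ _ _ assms]
    by metis
  then show ?thesis
    by (auto simp: matrix_graded_def matrices_def component_of_set_iff assms)
qed

lemma component_MR_I:
  assumes "x \<in> arrows G" "\<And>i j. entry A i j \<noteq> 0 \<Longrightarrow> i \<in> I \<and> j \<in> I"
    and "\<And>i j. i \<in> I \<Longrightarrow> j \<in> I \<Longrightarrow> entry A i j \<noteq> 0 \<Longrightarrow>
      \<exists>y. shifts i j x y \<and> entry A i j \<in> component R y"
  shows "A \<in> component MR x"
  using assms unfolding component_MR_iff[OF assms(1)] by blast

lemma entry_MR:
  assumes "A \<in> component MR x" "x \<in> arrows G" "entry A i j \<noteq> 0"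
  obtains y where "i \<in> I" "j \<in> I" "shifts i j x y" "y \<in> arrows G" "entry A i j \<in> component R y"
proof -
  have "i \<in> I" "j \<in> I" using assms(1,3) unfolding component_MR_iff[OF assms(2)] by blast+
  moreover from this obtain y where "shifts i j x y" "entry A i j \<in> component R y"
    using assms(1,3) unfolding component_MR_iff[OF assms(2)] by blast
  ultimately show thesis using that shifts_arrow assms(2) by blast
qed

lemma entry_component:
  assumes "A \<in> component MR x" "x \<in> arrows G" "shifts i j x y" "i \<in> I" "j \<in> I"
  shows "entry A i j \<in> component R y"
proof (cases "entry A i j = 0")
  case True
  then show ?thesis
    using additive_subgroupD(1)[OF component_subgroup] shifts_arrow[OF assms(3-5,2)] by simp
next
  case False
  then obtain z where "shifts i j x z" "entry A i j \<in> component R z"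
    using entry_MR[OF assms(1,2)] by metis
  then show ?thesis using shifts_unique[OF assms(3) _ assms(4,5)] by metis
qed

lemma component_MR_total:
  assumes "A \<in> component MR x"
  shows "A \<in> total MR"
  using assms by (simp add: matrix_graded_def)

section \<open>The matrix ring as the direct sum of its components\<close>

lemma total_MR_subgroup: "additive_subgroup (total MR)"
  unfolding additive_subgroup_def
proof (intro conjI ballI)
  have off: "entry A i j = 0" if "A \<in> total MR" "i \<notin> I \<or> j \<notin> I" for A i j
    using that unfolding total_MR_iff by blast
  show "0 \<in> total MR"
    by (simp add: total_MR_iff entry_zero additive_subgroupD(1)[OF total_subgroup])
  show "A + B \<in> total MR" if A: "A \<in> total MR" and B: "B \<in> total MR" for A B
    unfolding total_MR_iff entry_add
    using additive_subgroupD(2)[OF total_subgroup] entry_total[OF A] entry_total[OF B]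
      off[OF A] off[OF B] by simp
  show "- A \<in> total MR" if A: "A \<in> total MR" for A
    unfolding total_MR_iff entry_minus
    using additive_subgroupD(3)[OF total_subgroup] entry_total[OF A] off[OF A] by simp
qed

lemma component_MR_subgroup:
  assumes x: "x \<in> arrows G"
  shows "additive_subgroup (component MR x)"
  unfolding additive_subgroup_def
proof (intro conjI ballI)
  show "0 \<in> component MR x" by (rule component_MR_I[OF x]) (simp_all add: entry_zero)
  show "A + B \<in> component MR x" if A: "A \<in> component MR x" and B: "B \<in> component MR x" for A B
  proof (rule component_MR_I[OF x])
    fix i j assume nz: "entry (A + B) i j \<noteq> 0"
    then have "entry A i j \<noteq> 0 \<or> entry B i j \<noteq> 0" by (auto simp: entry_add)
    then obtain y where y: "i \<in> I" "j \<in> I" "shifts i j x y" "y \<in> arrows G"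
      using entry_MR[OF A x] entry_MR[OF B x] by metis
    show "i \<in> I \<and> j \<in> I" using y by simp
    have "entry (A + B) i j \<in> component R y"
      using additive_subgroupD(2)[OF component_subgroup[OF y(4)]]
        entry_component[OF A x y(3,1,2)] entry_component[OF B x y(3,1,2)] by (simp add: entry_add)
    then show "\<exists>y. shifts i j x y \<and> entry (A + B) i j \<in> component R y" using y(3) by blast
  qed
  show "- A \<in> component MR x" if A: "A \<in> component MR x" for A
  proof (rule component_MR_I[OF x])
    fix i j assume nz: "entry (- A) i j \<noteq> 0"
    then obtain y where y: "i \<in> I" "j \<in> I" "shifts i j x y" "y \<in> arrows G"
        "entry A i j \<in> component R y"
      using entry_MR[OF A x, of i j] by (auto simp: entry_minus)
    show "i \<in> I \<and> j \<in> I" using y by simp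
    have "entry (- A) i j \<in> component R y"
      using additive_subgroupD(3)[OF component_subgroup[OF y(4)] y(5)] by (simp add: entry_minus)
    then show "\<exists>y. shifts i j x y \<and> entry (- A) i j \<in> component R y" using y(3) by blast
  qed
qed

text \<open>The entrywise part at \<open>(i, j)\<close> of the projection to matrix degree
  \<open>x\<close>. The value \<open>0\<close> where \<open>x\<close> induces no degree matches the
  convention that the component of the empty set is zero.\<close>

definition proj :: "'i \<Rightarrow> 'i \<Rightarrow> 'g \<Rightarrow> 'a \<Rightarrow> 'a" where
  "proj i j x a =
     (if x \<in> arrows G \<and> i \<in> I \<and> j \<in> I \<and> (\<exists>y. shifts i j x y)
      then hcomp a (THE y. shifts i j x y) else 0)"

lemma proj_eq:
  assumes "x \<in> arrows G" "i \<in> I" "j \<in> I" "shifts i j x y"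
  shows "proj i j x a = hcomp a y"
proof -
  have "(THE y. shifts i j x y) = y"
    using assms shifts_unique by (blast intro: the_equality)
  then show ?thesis using assms by (auto simp: proj_def)
qed

text \<open>Hides the choice operator: the projection at a position is either a component map of
  \<open>R\<close> or zero, for all arguments at once.\<close>

lemma proj_cases:
  obtains y where "x \<in> arrows G" "i \<in> I" "j \<in> I" "shifts i j x y" "y \<in> arrows G"
      "\<And>a. proj i j x a = hcomp a y"
  | "\<And>a. proj i j x a = 0"
proof (cases "x \<in> arrows G \<and> i \<in> I \<and> j \<in> I \<and> (\<exists>y. shifts i j x y)")
  case True
  then obtain y where "x \<in> arrows G" "i \<in> I" "j \<in> I" "shifts i j x y" by blast
  with proj_eq shifts_arrow show ?thesis using that(1) by blast
next
  case False
  then have "proj i j x a = 0" for a unfolding proj_def by (rule if_not_P)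
  then show ?thesis by (rule that(2))
qed

lemma proj_zero: "proj i j x 0 = 0"
  by (rule proj_cases[of x i j]) (simp_all add: summand_zero[OF direct_sum])

lemma proj_add:
  "a \<in> total R \<Longrightarrow> b \<in> total R \<Longrightarrow> proj i j x (a + b) = proj i j x a + proj i j x b"
  by (rule proj_cases[of x i j]) (simp_all add: hcomp_add)

definition mproj :: "'g \<Rightarrow> ('i, 'a) fin_matrix \<Rightarrow> ('i, 'a) fin_matrix" where
  "mproj x A = Abs_fin_matrix (\<lambda>i j. proj i j x (entry A i j))"

lemma entry_mproj: "entry (mproj x A) i j = proj i j x (entry A i j)"
proof -
  have "finite {(i, j). proj i j x (entry A i j) \<noteq> 0}"
    by (rule finite_subset[OF _ finite_entry[of A]]) (auto simp: proj_zero)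
  then show ?thesis by (simp add: mproj_def entry_Abs)
qed

lemma mproj_component:
  assumes A: "A \<in> total MR" and x: "x \<in> arrows G"
  shows "mproj x A \<in> component MR x"
proof (rule component_MR_I[OF x])
  fix i j assume nz: "entry (mproj x A) i j \<noteq> 0"
  show "i \<in> I \<and> j \<in> I"
    by (rule proj_cases[of x i j]) (use nz in \<open>simp_all add: entry_mproj\<close>)
  show "\<exists>y. shifts i j x y \<and> entry (mproj x A) i j \<in> component R y"
  proof (rule proj_cases[of x i j])
    fix y assume "shifts i j x y" "y \<in> arrows G" "\<And>a. proj i j x a = hcomp a y"
    then show ?thesis using hcomp_component[OF entry_total[OF A]] by (auto simp: entry_mproj)
  qed (use nz in \<open>simp add: entry_mproj\<close>)
qed

lemma mproj_decomposition:
  assumes A: "A \<in> total MR"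
  shows "decomposition (arrows G) (component MR) A (\<lambda>x. mproj x A)"
proof -
  let ?F = "{x. mproj x A \<noteq> 0}"
  let ?S = "{(i, j). entry A i j \<noteq> 0}"
  \<comment> \<open>\<open>g i j\<close> is the inverse, at position \<open>(i, j)\<close>, of the
    partial map from matrix degrees to entry degrees; \<open>shifts_inj\<close> makes it well
    defined.\<close>
  define g where "g i j y = (THE x. x \<in> arrows G \<and> shifts i j x y)" for i j y
  have g: "g i j y = x" if "shifts i j x y" "x \<in> arrows G" "i \<in> I" "j \<in> I" for i j x y
    unfolding g_def using that shifts_inj by (blast intro: the_equality)
  have outside: "mproj x A = 0" if "x \<notin> arrows G" for x
    by (rule fin_matrix_eqI) (simp add: entry_mproj entry_zero proj_def that)
  have nz: "\<exists>y. shifts i j x y \<and> hcomp (entry A i j) y \<noteq> 0 \<and> x \<in> arrows G \<and> i \<in> I \<and> j \<in> I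
      \<and> x = g i j y"
    if "proj i j x (entry A i j) \<noteq> 0" for i j x
  proof (rule proj_cases[of x i j])
    fix y assume y: "x \<in> arrows G" "i \<in> I" "j \<in> I" "shifts i j x y"
      "\<And>a. proj i j x a = hcomp a y"
    have "hcomp (entry A i j) y \<noteq> 0" using that unfolding y(5) .
    then show ?thesis using y(1-4) g[OF y(4,1-3)] by metis
  next
    assume "\<And>a. proj i j x a = 0"
    then show ?thesis using that by simp
  qed
  \<comment> \<open>A nonzero \<open>mproj x A\<close> has a nonzero entry, which is a component of
    an entry of \<open>A\<close> and determines \<open>x\<close>. Finitely many entries with
    finitely many components leave finitely many \<open>x\<close>.\<close>
  have "?F \<subseteq> (\<Union>(i, j)\<in>?S. g i j ` {y. hcomp (entry A i j) y \<noteq> 0})"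
  proof
    fix x assume "x \<in> ?F"
    then obtain i j where ij: "proj i j x (entry A i j) \<noteq> 0"
      using fin_matrix_eqI[of "mproj x A" 0] by (auto simp: entry_mproj entry_zero)
    then have "(i, j) \<in> ?S" by (auto simp: proj_zero)
    moreover have "x \<in> g i j ` {y. hcomp (entry A i j) y \<noteq> 0}" using nz[OF ij] by blast
    ultimately show "x \<in> (\<Union>(i, j)\<in>?S. g i j ` {y. hcomp (entry A i j) y \<noteq> 0})" by blast
  qed
  moreover have "finite (\<Union>(i, j)\<in>?S. g i j ` {y. hcomp (entry A i j) y \<noteq> 0})"
    using finite_entry[of A] finite_hcomp[OF entry_total[OF A]] by auto
  ultimately have F: "finite ?F" by (rule finite_subset)
  have "A = (\<Sum>x\<in>?F. mproj x A)"
  proof (rule fin_matrix_eqI)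
    fix i j
    let ?a = "entry A i j"
    let ?K = "{y. hcomp ?a y \<noteq> 0}"
    show "?a = entry (\<Sum>x\<in>?F. mproj x A) i j"
    proof (cases "i \<in> I \<and> j \<in> I")
      case False
      then have "?a = 0" using A unfolding total_MR_iff by blast
      then show ?thesis by (simp add: entry_sum entry_mproj proj_zero)
    next
      case True
      have a: "?a \<in> total R" by (rule entry_total[OF A])
      have K: "shifts i j (g i j y) y \<and> g i j y \<in> arrows G" if "y \<in> ?K" for y
      proof -
        have "hcomp ?a y \<noteq> 0" using that by simp
        moreover from this have "y \<in> arrows G" using hcomp_outside[OF a] by blast
        ultimately obtain x where "x \<in> arrows G" "shifts i j x y"
          using shifts_surj[of y i j] nonzero_ends[OF _ hcomp_component[OF a]] True by blast
        then show ?thesis using g True by auto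
      qed
      have p: "proj i j (g i j y) ?a = hcomp ?a y" if "y \<in> ?K" for y
        using proj_eq K[OF that] True by blast
      have inj: "inj_on (g i j) ?K"
        by (rule inj_onI) (metis K shifts_unique True)
      have sub: "g i j ` ?K \<subseteq> ?F"
      proof
        fix x assume "x \<in> g i j ` ?K"
        then obtain y where y: "y \<in> ?K" "x = g i j y" by blast
        have "entry (mproj x A) i j \<noteq> 0" using p[OF y(1)] y by (simp add: entry_mproj)
        then show "x \<in> ?F" by (auto simp: entry_zero)
      qed
      have "entry (\<Sum>x\<in>?F. mproj x A) i j = (\<Sum>x\<in>?F. proj i j x ?a)"
        by (simp add: entry_sum entry_mproj)
      \<comment> \<open>Other degrees in \<open>?F\<close> come from other positions and contribute
        \<open>0\<close> here.\<close>
      also have "\<dots> = (\<Sum>x\<in>g i j ` ?K. proj i j x ?a)"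
        by (rule sum.mono_neutral_right[OF F sub]) (use nz in blast)
      also have "\<dots> = (\<Sum>y\<in>?K. hcomp ?a y)"
        unfolding sum.reindex[OF inj] by (rule sum.cong) (use p in auto)
      also have "\<dots> = ?a" by (rule sum_hcomp[OF a])
      finally show ?thesis ..
    qed
  qed
  then show ?thesis
    unfolding decomposition_def using F outside mproj_component[OF A] by blast
qed

lemma direct_sum_MR: "is_direct_sum (arrows G) (component MR) (total MR)"
proof (rule is_direct_sumI[where p = mproj])
  show "mproj x (A + B) = mproj x A + mproj x B" if "A \<in> total MR" "B \<in> total MR" for x A B
    by (rule fin_matrix_eqI)
      (simp add: entry_mproj entry_add proj_add entry_total[OF that(1)] entry_total[OF that(2)])
  show "mproj x A = A" if x: "x \<in> arrows G" and A: "A \<in> component MR x" for x A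
  proof (rule fin_matrix_eqI)
    fix i j
    show "entry (mproj x A) i j = entry A i j"
    proof (cases "entry A i j = 0")
      case True
      then show ?thesis by (simp add: entry_mproj proj_zero)
    next
      case False
      then obtain y where y: "i \<in> I" "j \<in> I" "shifts i j x y" "y \<in> arrows G"
          "entry A i j \<in> component R y"
        using entry_MR[OF A x] by metis
      then show ?thesis
        using proj_eq[OF x y(1-3)] hcomp_homogeneous[OF y(4,5)] by (simp add: entry_mproj)
    qed
  qed
  show "mproj x A = 0" if x: "x \<in> arrows G" "z \<in> arrows G" "x \<noteq> z" and A: "A \<in> component MR z"
    for x z A
  proof (rule fin_matrix_eqI)
    fix i j
    show "entry (mproj x A) i j = entry 0 i j"
    proof (cases "entry A i j = 0")
      case True
      then show ?thesis by (simp add: entry_mproj proj_zero entry_zero)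
    next
      case False
      then obtain y where y: "i \<in> I" "j \<in> I" "shifts i j z y" "y \<in> arrows G"
          "entry A i j \<in> component R y"
        using entry_MR[OF A x(2)] by metis
      show ?thesis
      proof (rule proj_cases[of x i j])
        fix w assume w: "shifts i j x w" "\<And>a. proj i j x a = hcomp a w"
        \<comment> \<open>Distinct matrix degrees induce distinct degrees at the same position, so
          the component of degree \<open>w\<close> of an element of degree \<open>y\<close>
          vanishes.\<close>
        have "w \<noteq> y" using shifts_inj[OF w(1) _ y(1,2) x(1,2)] y(3) x(3) by blast
        then show ?thesis
          using w(2) hcomp_homogeneous[OF y(4,5)] by (simp add: entry_mproj entry_zero)
      qed (simp add: entry_mproj entry_zero)
    qed
  qed
qed (use total_MR_subgroup component_MR_subgroup component_MR_total mproj_decomposition in blast)+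

section \<open>Products and local units of the matrix ring\<close>

lemma mult_total_MR:
  assumes A: "A \<in> total MR" and B: "B \<in> total MR"
  shows "A * B \<in> total MR"
proof -
  have "entry (A * B) i j \<in> total R" for i j
    unfolding times_fin_matrix.rep_eq
    by (rule additive_subgroup_sum[OF total_subgroup])
      (rule mult_total[OF entry_total[OF A] entry_total[OF B]])
  moreover have "entry (A * B) i j = 0" if "i \<notin> I \<or> j \<notin> I" for i j
    unfolding times_fin_matrix.rep_eq
  proof (rule sum.neutral, rule ballI)
    fix k
    have "entry A i k = 0 \<or> entry B k j = 0" using A B that unfolding total_MR_iff by blast
    then show "entry A i k * entry B k j = 0" by auto
  qed
  ultimately show ?thesis unfolding total_MR_iff by blast
qed

text \<open>A nonzero product of entries has composable degrees in \<open>R\<close>, and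
  \<open>shifts_mult\<close> lifts this to \<open>x\<close> and \<open>x'\<close>. It serves both
  grading axioms: products land in the right degree, and vanish if \<open>x x'\<close> is
  undefined.\<close>

lemma mult_MR_entry:
  assumes A: "A \<in> component MR x" and B: "B \<in> component MR x'"
    and x: "x \<in> arrows G" "x' \<in> arrows G" and nz: "entry A i k * entry B k j \<noteq> 0"
  shows "gdom G x = gcod G x' \<and> i \<in> I \<and> j \<in> I \<and>
    (\<exists>z. shifts i j (gmult G x x') z \<and> entry A i k * entry B k j \<in> component R z)"
proof -
  have "entry A i k \<noteq> 0" using nz by auto
  then obtain y where y: "i \<in> I" "k \<in> I" "shifts i k x y" "y \<in> arrows G"
      "entry A i k \<in> component R y"
    using entry_MR[OF A x(1)] by metis
  have "entry B k j \<noteq> 0" using nz by auto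
  then obtain y' where y': "j \<in> I" "shifts k j x' y'" "y' \<in> arrows G"
      "entry B k j \<in> component R y'"
    using entry_MR[OF B x(2)] by metis
  have "gdom G y = gcod G y'" using mult_eq_0[OF y(4) y'(3) y(5) y'(4)] nz by blast
  then show ?thesis
    using shifts_mult[OF y(3) y'(2) y(1) y'(1) y(2) x] y(1) y'(1)
      mult_component[OF y(4) y'(3) y(5) y'(4)] by blast
qed

lemma mult_component_MR:
  assumes A: "A \<in> component MR x" and B: "B \<in> component MR x'"
    and x: "x \<in> arrows G" "x' \<in> arrows G" "gdom G x = gcod G x'"
  shows "A * B \<in> component MR (gmult G x x')"
proof -
  have xx: "gmult G x x' \<in> arrows G" using x by (rule mult_closed)
  show ?thesis
  proof (rule component_MR_I[OF xx])
    fix i j assume "entry (A * B) i j \<noteq> 0"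
    then have "(\<Sum>k | entry A i k \<noteq> 0. entry A i k * entry B k j) \<noteq> 0"
      by (simp add: times_fin_matrix.rep_eq)
    then obtain k where "entry A i k * entry B k j \<noteq> 0" by (meson sum.neutral)
    from mult_MR_entry[OF A B x(1,2) this] obtain z
      where ij: "i \<in> I" "j \<in> I" and z: "shifts i j (gmult G x x') z" by blast
    show "i \<in> I \<and> j \<in> I" using ij by simp
    have sub: "additive_subgroup (component R z)"
      using component_subgroup shifts_arrow[OF z ij xx] by blast
    have "entry (A * B) i j \<in> component R z"
      unfolding times_fin_matrix.rep_eq
    proof (rule additive_subgroup_sum[OF sub])
      fix k
      show "entry A i k * entry B k j \<in> component R z"
      proof (cases "entry A i k * entry B k j = 0")
        case True
        then show ?thesis using additive_subgroupD(1)[OF sub] by simp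
      next
        case False
        from mult_MR_entry[OF A B x(1,2) this] obtain w
          where "shifts i j (gmult G x x') w" "entry A i k * entry B k j \<in> component R w" by blast
        then show ?thesis using shifts_unique[OF z _ ij] by metis
      qed
    qed
    then show "\<exists>y. shifts i j (gmult G x x') y \<and> entry (A * B) i j \<in> component R y"
      using z by blast
  qed
qed

lemma mult_eq_0_MR:
  assumes A: "A \<in> component MR x" and B: "B \<in> component MR x'"
    and x: "x \<in> arrows G" "x' \<in> arrows G" "gdom G x \<noteq> gcod G x'"
  shows "A * B = 0"
proof (rule fin_matrix_eqI)
  fix i j
  have "entry A i k * entry B k j = 0" for k
    using mult_MR_entry[OF A B x(1,2)] x(3) by blast
  then show "entry (A * B) i j = entry 0 i j"
    by (simp add: times_fin_matrix.rep_eq entry_zero)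
qed

text \<open>The identity of the component of degree \<open>e\<close>. Injectivity of
  \<open>d\<close> on \<open>\<Sigma> i\<close> makes \<open>s\<close> unique, and the finiteness
  condition on the family leaves finitely many nonzero diagonal entries even for infinite
  \<open>I\<close>.\<close>

definition munit :: "'g \<Rightarrow> ('i, 'a) fin_matrix" where
  "munit e = Abs_fin_matrix (\<lambda>i j.
     if i = j \<and> i \<in> I \<and> (\<exists>s\<in>\<Sigma> i. gdom G s = e)
     then unit_at R (gcod G (THE s. s \<in> \<Sigma> i \<and> gdom G s = e)) else 0)"

lemma entry_munit:
  assumes "e \<in> identities G"
  shows "entry (munit e) i j = (if i = j \<and> i \<in> I \<and> (\<exists>s\<in>\<Sigma> i. gdom G s = e)
     then unit_at R (gcod G (THE s. s \<in> \<Sigma> i \<and> gdom G s = e)) else 0)"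
proof -
  have "finite {(i, j). (if i = j \<and> i \<in> I \<and> (\<exists>s\<in>\<Sigma> i. gdom G s = e)
     then unit_at R (gcod G (THE s. s \<in> \<Sigma> i \<and> gdom G s = e)) else 0) \<noteq> 0}"
    by (rule finite_subset[of _ "(\<lambda>i. (i, i)) ` {i \<in> I. \<exists>s\<in>\<Sigma> i. gdom G s = e}"])
      (use finite_indices[OF assms] in \<open>auto split: if_splits\<close>)
  then show ?thesis by (simp add: munit_def entry_Abs)
qed

lemma entry_munit_diag:
  assumes "i \<in> I" "s \<in> \<Sigma> i"
  shows "entry (munit (gdom G s)) i i = unit_at R (gcod G s)"
proof -
  have "(THE t. t \<in> \<Sigma> i \<and> gdom G t = gdom G s) = s"
    using assms dom_inj by (intro the_equality) auto
  then show ?thesis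
    using assms dom_identity[OF Sigma_arrows[OF assms]] by (auto simp: entry_munit)
qed

lemma munit_component:
  assumes e: "e \<in> identities G"
  shows "munit e \<in> component MR e"
proof (rule component_MR_I[OF identitiesD(1)[OF e]])
  fix i j assume nz: "entry (munit e) i j \<noteq> 0"
  then have ij: "i = j" "i \<in> I" and "\<exists>s\<in>\<Sigma> i. gdom G s = e"
    unfolding entry_munit[OF e] by (auto split: if_splits)
  then obtain s where s: "s \<in> \<Sigma> i" "gdom G s = e" by blast
  show "i \<in> I \<and> j \<in> I" using ij by simp
  have "entry (munit e) i j = unit_at R (gcod G s)"
    using entry_munit_diag[OF ij(2) s(1)] s(2) ij(1) by simp
  moreover have "unit_at R (gcod G s) \<in> component R (gcod G s)"
    using unit_component cod_identity Sigma_arrows[OF ij(2) s(1)] by blast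
  moreover have "shifts i j e (gcod G s)" using shifts_identity[OF ij(2) s(1)] s(2) ij(1) by simp
  ultimately show "\<exists>y. shifts i j e y \<and> entry (munit e) i j \<in> component R y" by auto
qed

text \<open>A nonzero entry in row \<open>i\<close> has degree \<open>y = s x t^-1\<close> with
  \<open>d(s) = r(x)\<close> and \<open>r(y) = r(s)\<close>, so the diagonal entry it meets is
  exactly \<open>1_r(y)\<close>.\<close>

lemma munit_left:
  assumes A: "A \<in> component MR x" and x: "x \<in> arrows G"
  shows "munit (gcod G x) * A = A"
proof (rule fin_matrix_eqI)
  fix i j
  let ?U = "munit (gcod G x)"
  have "entry (?U * A) i j = (\<Sum>k\<in>{i}. entry ?U i k * entry A k j)"
    by (rule entry_times_superset) (auto simp: entry_munit[OF cod_identity[OF x]])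
  also have "\<dots> = entry A i j"
  proof (cases "entry A i j = 0")
    case False
    then obtain y where y: "i \<in> I" "j \<in> I" "shifts i j x y" "y \<in> arrows G"
        "entry A i j \<in> component R y"
      using entry_MR[OF A x] by metis
    obtain s where s: "s \<in> \<Sigma> i" "gdom G s = gcod G x" "gcod G y = gcod G s"
      using shiftsE[OF y(3,1,2) x] by metis
    show ?thesis
      using entry_munit_diag[OF y(1) s(1)] s unit_left[OF y(4,5)] by simp
  qed simp
  finally show "entry (?U * A) i j = entry A i j" .
qed

lemma munit_right:
  assumes A: "A \<in> component MR x" and x: "x \<in> arrows G"
  shows "A * munit (gdom G x) = A"
proof (rule fin_matrix_eqI)
  fix i j
  let ?U = "munit (gdom G x)" and ?K = "insert j {k. entry A i k \<noteq> 0}"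
  have U: "entry ?U k j = 0" if "k \<noteq> j" for k
    using that by (simp add: entry_munit[OF dom_identity[OF x]])
  have "entry (A * ?U) i j = (\<Sum>k\<in>?K. entry A i k * entry ?U k j)"
    by (rule entry_times_superset) (auto simp: finite_row)
  also have "\<dots> = (\<Sum>k\<in>?K. if k = j then entry A i j * entry ?U j j else 0)"
    by (rule sum.cong) (auto simp: U)
  also have "\<dots> = entry A i j * entry ?U j j" by (simp add: finite_row)
  also have "\<dots> = entry A i j"
  proof (cases "entry A i j = 0")
    case False
    then obtain y where y: "i \<in> I" "j \<in> I" "shifts i j x y" "y \<in> arrows G"
        "entry A i j \<in> component R y"
      using entry_MR[OF A x] by metis
    obtain t where t: "t \<in> \<Sigma> j" "gdom G t = gdom G x" "gdom G y = gcod G t"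
      using shiftsE[OF y(3,1,2) x] by metis
    show ?thesis
      using entry_munit_diag[OF y(2) t(1)] t unit_right[OF y(4,5)] by simp
  qed simp
  finally show "entry (A * ?U) i j = entry A i j" .
qed

lemma munit_is_unit:
  assumes e: "e \<in> identities G"
  shows "is_unit_of (component MR e) (munit e)"
  unfolding is_unit_of_def
  using munit_component[OF e] munit_left[of _ e] munit_right[of _ e] identitiesD[OF e] by auto

lemma unit_at_MR:
  assumes "e \<in> identities G"
  shows "unit_at MR e = munit e"
  unfolding unit_at_def
proof (rule the_equality)
  show "is_unit_of (component MR e) (munit e)" by (rule munit_is_unit[OF assms])
  show "U = munit e" if "is_unit_of (component MR e) U" for U
    using munit_is_unit[OF assms] that unfolding is_unit_of_def by metis
qed

lemma graded_ring_MR: "graded_ring G MR"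
  unfolding graded_ring_def
proof (intro conjI ballI)
  fix x y A B
  assume "x \<in> arrows G" "y \<in> arrows G" "A \<in> component MR x" "B \<in> component MR y"
  then show "if gdom G x = gcod G y then A * B \<in> component MR (gmult G x y) else A * B = 0"
    using mult_component_MR mult_eq_0_MR by simp
next
  fix x A assume "x \<in> arrows G" "A \<in> component MR x"
  then show "unit_at MR (gcod G x) * A = A" "A * unit_at MR (gdom G x) = A"
    using munit_left munit_right by (simp_all add: unit_at_MR cod_identity dom_identity)
qed (use mult_total_MR direct_sum_MR munit_is_unit in blast)+

end

text \<open>Makes the closure properties of the radical and the invertibility criterion available
  for the matrix ring.\<close>

sublocale matricial_ring \<subseteq> MR: object_unital_ring G MR
  by unfold_locales (rule graded_ring_MR)

section \<open>The graded radical of a matrix ring\<close>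

context matricial_ring
begin

text \<open>\<open>mproj\<close> gives a decomposition, so by uniqueness it is the one chosen by
  \<open>summand\<close>. Entries of components thereby become components of entries.\<close>

lemma entry_hcomp:
  assumes "A \<in> total MR"
  shows "entry (MR.hcomp A x) i j = proj i j x (entry A i j)"
  using summand_unique[OF direct_sum_MR assms mproj_decomposition[OF assms]]
  by (simp add: entry_mproj)

lemma single_component:
  assumes "x \<in> arrows G" "i \<in> I" "j \<in> I" "shifts i j x y" "a \<in> component R y"
  shows "single i j a \<in> component MR x"
  by (rule component_MR_I[OF assms(1)]) (use assms in \<open>auto simp: entry_single split: if_splits\<close>)

text \<open>Right invertibility of \<open>1 - A E\<^sub>j\<^sub>i(b)\<close> is read off at the entry \<open>(i, i)\<close>, since
  \<open>A E\<^sub>j\<^sub>i(b)\<close> is concentrated in column \<open>i\<close>.\<close>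

lemma entry_in_gr_rad:
  assumes A: "A \<in> component MR x" "A \<in> gr_rad G MR" and x: "x \<in> arrows G"
    and ij: "i \<in> I" "j \<in> I" and y: "shifts i j x y"
  shows "entry A i j \<in> gr_rad G R"
proof -
  have yA: "y \<in> arrows G" by (rule shifts_arrow[OF y ij x])
  have a: "entry A i j \<in> component R y" by (rule entry_component[OF A(1) x y ij])
  obtain s where s: "s \<in> \<Sigma> i" "s \<in> arrows G" "gdom G s = gcod G x" "gcod G y = gcod G s"
    using y ij x by (elim shiftsE)
  have e: "gcod G x \<in> identities G" "gcod G x \<in> arrows G" using x cod_identity cod_closed by auto
  show ?thesis
    unfolding homogeneous_gr_rad_iff[OF yA a]
  proof
    fix b assume b: "b \<in> component R (ginv G y)"
    have "single j i b \<in> component MR (ginv G x)"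
      by (rule single_component[OF inv_closed[OF x] ij(2,1) shifts_inverse[OF y ij x] b])
    then obtain C where C: "C \<in> component MR (gcod G x)"
        "C - A * single j i b * C = unit_at MR (gcod G x)"
      using A(2) MR.homogeneous_gr_rad_iff[OF x A(1)] by blast
    \<comment> \<open>At \<open>(i, i)\<close> the matrix degree \<open>r(x)\<close> induces
      \<open>r(y)\<close>, the degree in which the criterion for \<open>entry A i j\<close> asks for
      \<open>c\<close>.\<close>
    have sh: "shifts i i (gcod G x) (gcod G y)" using shifts_identity[OF ij(1) s(1)] s(3,4) by simp
    have c: "entry C i i \<in> component R (gcod G y)"
      by (rule entry_component[OF C(1) e(2) sh ij(1) ij(1)])
    have "entry (A * single j i b * C) i i
        = (\<Sum>k\<in>{i}. entry (A * single j i b) i k * entry C k i)"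
      by (rule entry_times_superset) (auto simp: entry_mult_single)
    then have "entry C i i - entry A i j * b * entry C i i = entry (unit_at MR (gcod G x)) i i"
      using C(2)[symmetric] by (simp add: entry_diff entry_mult_single)
    also have "\<dots> = unit_at R (gcod G y)"
      using entry_munit_diag[OF ij(1) s(1)] s(3,4) by (simp add: unit_at_MR[OF e(1)])
    finally show "\<exists>c\<in>component R (gcod G y). c - entry A i j * b * c = unit_at R (gcod G y)"
      using c by blast
  qed
qed

text \<open>Each nonzero component of an entry is an entry of a homogeneous component of
  \<open>A\<close>, because its degree is induced by some \<open>x\<close> at that position.\<close>

lemma gr_rad_subset_matrix_ideal: "gr_rad G MR \<subseteq> matrix_ideal G R I \<Sigma> (gr_rad G R)"
proof
  fix A assume A: "A \<in> gr_rad G MR"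
  have At: "A \<in> total MR" by (rule MR.gr_rad_total[OF A])
  have "entry A i j \<in> gr_rad G R" if ij: "i \<in> I" "j \<in> I" for i j
  proof (rule gr_rad_hcompI[OF entry_total[OF At]])
    fix y assume y: "y \<in> arrows G"
    let ?a = "hcomp (entry A i j) y"
    show "?a \<in> gr_rad G R"
    proof (cases "?a = 0")
      case True
      then show ?thesis using additive_subgroupD(1)[OF gr_rad_subgroup] by simp
    next
      case False
      have "?a \<in> component R y" by (rule hcomp_component[OF entry_total[OF At] y])
      then obtain x where x: "x \<in> arrows G" "shifts i j x y"
        using shifts_surj[OF y nonzero_ends[OF y _ False] ij] by blast
      have "entry (MR.hcomp A x) i j \<in> gr_rad G R"
        by (rule entry_in_gr_rad[OF MR.hcomp_component[OF At x(1)] MR.gr_rad_hcomp[OF A x(1)]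
              x(1) ij x(2)])
      then show ?thesis by (simp add: entry_hcomp[OF At] proj_eq[OF x(1) ij x(2)])
    qed
  qed
  then show "A \<in> matrix_ideal G R I \<Sigma> (gr_rad G R)"
    using At by (simp add: matrix_ideal_def)
qed

text \<open>If \<open>X = A B\<close> is concentrated in row \<open>i\<close> and \<open>(1 - x\<^sub>i\<^sub>i) c = 1\<close>, then
  \<open>1 + E\<^sub>i\<^sub>i(c) X\<close> is a right inverse of \<open>1 - X\<close>.\<close>

lemma row_in_gr_rad:
  assumes A: "A \<in> component MR x" and x: "x \<in> arrows G" and i: "i \<in> I"
    and row: "\<And>k l. k \<noteq> i \<Longrightarrow> entry A k l = 0"
    and rad: "\<And>l. entry A i l \<in> gr_rad G R"
  shows "A \<in> gr_rad G MR"
  unfolding MR.homogeneous_gr_rad_iff[OF x A]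
proof
  fix B assume B: "B \<in> component MR (ginv G x)"
  define e where "e = gcod G x"
  have e: "e \<in> identities G" using cod_identity[OF x] by (simp add: e_def)
  note eA = identitiesD[OF e]
  define X where "X = A * B"
  have X: "X \<in> component MR e"
    using mult_component_MR[OF A B x inv_closed[OF x]] cod_inv[OF x]
    by (simp add: X_def e_def mult_inv)
  have Xrow: "entry X k l = 0" if "k \<noteq> i" for k l
    unfolding X_def times_fin_matrix.rep_eq by (simp add: row[OF that])
  have Xrad: "entry X i l \<in> gr_rad G R" for l
    unfolding X_def times_fin_matrix.rep_eq
    by (rule gr_rad_sum) (rule gr_rad_mult[OF rad entry_total[OF component_MR_total[OF B]]])
  have "\<exists>C\<in>component MR e. C - X * C = munit e"
  proof (cases "\<exists>s\<in>\<Sigma> i. gdom G s = e")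
    case False
    \<comment> \<open>Without \<open>s \<in> \<Sigma> i\<close> of domain \<open>e\<close>, a matrix
      of degree \<open>e\<close> has zero row \<open>i\<close>, and \<open>X\<close> has no other
      row. The unit is then its own right inverse.\<close>
    have "X = 0"
    proof (rule fin_matrix_eqI)
      fix k l
      have "entry X k l = 0"
      proof (rule ccontr)
        assume nz: "entry X k l \<noteq> 0"
        then have "k = i" using Xrow by metis
        obtain y where y: "k \<in> I" "l \<in> I" "shifts k l e y" using entry_MR[OF X eA(1) nz] .
        obtain s where "s \<in> \<Sigma> k" "gdom G s = gcod G e" using shiftsE[OF y(3,1,2) eA(1)] .
        then show False using False eA(3) \<open>k = i\<close> by auto
      qed
      then show "entry X k l = entry 0 k l" by (simp add: entry_zero)
    qed
    then show ?thesis using munit_component[OF e] by (intro bexI[of _ "munit e"]) simp_all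
  next
    case True
    then obtain s where s: "s \<in> \<Sigma> i" "gdom G s = e" by blast
    define f where "f = gcod G s"
    have f: "f \<in> identities G"
      using cod_identity[OF Sigma_arrows[OF i s(1)]] by (simp add: f_def)
    note fA = identitiesD[OF f]
    have sh: "shifts i i e f" using shifts_identity[OF i s(1)] s(2) by (simp add: f_def)
    have xii: "entry X i i \<in> component R f" by (rule entry_component[OF X eA(1) sh i i])
    \<comment> \<open>The criterion is applied to \<open>x_ii\<close>, of degree the identity
      \<open>f\<close>, with \<open>b = 1_f\<close>.\<close>
    obtain c where c: "c \<in> component R f"
        "c - entry X i i * unit_at R f * c = unit_at R f"
      using homogeneous_gr_rad_iff[OF fA(1) xii] Xrad unit_component[OF f]
      by (auto simp: ginv_identity[OF f] fA)
    have "entry X i i * unit_at R f = entry X i i"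
      using unit_right[OF fA(1) xii] by (simp add: fA)
    with c(2) have c_eq: "c = unit_at R f + entry X i i * c" by (simp add: algebra_simps)
    let ?D = "single i i c"
    define Y where "Y = ?D * X"
    have D: "?D \<in> component MR e" by (rule single_component[OF eA(1) i i sh c(1)])
    have ee: "gmult G e e = e" using mult_dom[OF eA(1)] by (simp add: eA)
    have Y: "Y \<in> component MR e"
      using mult_component_MR[OF D X eA(1) eA(1)] by (simp add: Y_def ee eA)
    \<comment> \<open>This is what makes \<open>1 + Y\<close> a right inverse of
      \<open>1 - X\<close>. At \<open>(i, l)\<close> it is \<open>c_eq\<close> multiplied on the
      right by \<open>x_il\<close>; in all other rows both sides vanish.\<close>
    have eq: "Y = X + X * Y"
    proof (rule fin_matrix_eqI)
      fix k l
      have XY: "entry (X * Y) k l = entry (X * ?D) k i * entry X i l"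
      proof -
        have "entry (X * Y) k l = (\<Sum>m\<in>{i}. entry (X * ?D) k m * entry X m l)"
          unfolding Y_def mult.assoc[symmetric]
          by (rule entry_times_superset) (auto simp: entry_mult_single)
        then show ?thesis by simp
      qed
      show "entry Y k l = entry (X + X * Y) k l"
      proof (cases "k = i")
        case False
        then show ?thesis
          unfolding entry_add XY by (simp add: Y_def entry_single_mult entry_mult_single Xrow)
      next
        case True
        \<comment> \<open>In row \<open>i\<close> of degree \<open>e\<close> all nonzero entries
          have a degree with range \<open>f\<close>, because \<open>s\<close> is the only element of
          \<open>\<Sigma> i\<close> with domain \<open>e\<close>.\<close>
        have "unit_at R f * entry X i l = entry X i l"
        proof (cases "entry X i l = 0")
          case False
          then obtain y where y: "l \<in> I" "shifts i l e y" "y \<in> arrows G"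
              "entry X i l \<in> component R y"
            using entry_MR[OF X eA(1)] by metis
          obtain s' where s': "s' \<in> \<Sigma> i" "gdom G s' = gcod G e" "gcod G y = gcod G s'"
            using shiftsE[OF y(2) i y(1) eA(1)] .
          have "s' = s" using dom_inj[OF i s'(1) s(1)] s'(2) s(2) eA(3) by simp
          then show ?thesis using unit_left[OF y(3,4)] s'(3) by (simp add: f_def)
        qed simp
        then have "c * entry X i l = entry X i l + entry X i i * c * entry X i l"
          using arg_cong[OF c_eq, of "\<lambda>u. u * entry X i l"] by (simp add: distrib_right)
        then show ?thesis
          unfolding entry_add XY by (simp add: Y_def entry_single_mult entry_mult_single True)
      qed
    qed
    have "X * munit e = X" using munit_right[OF X eA(1)] by (simp add: eA)
    then have "munit e + Y - X * (munit e + Y) = munit e"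
      using eq by (simp add: distrib_left)
    moreover have "munit e + Y \<in> component MR e"
      using additive_subgroupD(2)[OF component_MR_subgroup[OF eA(1)] munit_component[OF e] Y] .
    ultimately show ?thesis by blast
  qed
  then show "\<exists>C\<in>component MR (gcod G x). C - A * B * C = unit_at MR (gcod G x)"
    using unit_at_MR[OF e] by (simp add: X_def e_def)
qed

text \<open>As the radical of \<open>R\<close> is graded, the homogeneous components of
  \<open>A\<close> again have entries in it, and so do their rows.\<close>

lemma matrix_ideal_subset_gr_rad: "matrix_ideal G R I \<Sigma> (gr_rad G R) \<subseteq> gr_rad G MR"
proof
  fix A assume "A \<in> matrix_ideal G R I \<Sigma> (gr_rad G R)"
  then have At: "A \<in> total MR" and Arad: "\<And>i j. i \<in> I \<Longrightarrow> j \<in> I \<Longrightarrow> entry A i j \<in> gr_rad G R"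
    by (auto simp: matrix_ideal_def)
  have zero: "0 \<in> gr_rad G R" by (rule additive_subgroupD(1)[OF gr_rad_subgroup])
  show "A \<in> gr_rad G MR"
  proof (rule MR.gr_rad_hcompI[OF At])
    fix x assume x: "x \<in> arrows G"
    let ?B = "MR.hcomp A x"
    have B: "?B \<in> component MR x" by (rule MR.hcomp_component[OF At x])
    have Brad: "entry ?B i j \<in> gr_rad G R" for i j
      unfolding entry_hcomp[OF At]
    proof (rule proj_cases[of x i j])
      fix y assume y: "i \<in> I" "j \<in> I" "y \<in> arrows G" "\<And>a. proj i j x a = hcomp a y"
      show "proj i j x (entry A i j) \<in> gr_rad G R"
        unfolding y(4) by (rule gr_rad_hcomp[OF Arad[OF y(1,2)] y(3)])
    qed (simp add: zero)
    \<comment> \<open>Only rows with a nonzero entry are kept: a finite set even if \<open>I\<close>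
      is infinite.\<close>
    let ?K = "fst ` {(i, j). entry ?B i j \<noteq> 0}"
    have row: "row_matrix i ?B \<in> gr_rad G MR" if "i \<in> ?K" for i
    proof (rule row_in_gr_rad[OF _ x])
      show "row_matrix i ?B \<in> component MR x"
      proof (rule component_MR_I[OF x])
        fix k l assume "entry (row_matrix i ?B) k l \<noteq> 0"
        then have eq: "entry (row_matrix i ?B) k l = entry ?B k l" and nz: "entry ?B k l \<noteq> 0"
          by (auto simp: entry_row_matrix split: if_splits)
        obtain y where "k \<in> I" "l \<in> I" "shifts k l x y" "entry ?B k l \<in> component R y"
          using entry_MR[OF B x nz] .
        then show "k \<in> I \<and> l \<in> I"
          "\<exists>y. shifts k l x y \<and> entry (row_matrix i ?B) k l \<in> component R y"
          unfolding eq by blast+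
      qed
      show "i \<in> I" using that entry_MR[OF B x] by auto
    qed (simp_all add: entry_row_matrix Brad)
    have "(\<Sum>i\<in>?K. row_matrix i ?B) \<in> gr_rad G MR" by (rule MR.gr_rad_sum) (rule row)
    moreover have "(\<Sum>i\<in>?K. row_matrix i ?B) = ?B"
      by (rule sum_row_matrix) (use finite_entry[of ?B] in force)+
    ultimately show "?B \<in> gr_rad G MR" by simp
  qed
qed

end

theorem proposition7p3:
  fixes G :: "'g groupoid_data"
    and R :: "('g, 'a::ring) graded_data"
    and I :: "'i set"
    and \<Sigma> :: "'i \<Rightarrow> 'g set"
  assumes "groupoid G"
    and "graded_ring G R"
    and "fully_matricial G R I \<Sigma>"
  shows "gr_rad G (matrix_graded G R I \<Sigma>) = matrix_ideal G R I \<Sigma> (gr_rad G R)"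
proof -
  interpret groupoid G by (rule assms(1))
  interpret matricial_ring G R I \<Sigma>
    by unfold_locales (use assms in auto)
  show ?thesis using gr_rad_subset_matrix_ideal matrix_ideal_subset_gr_rad by blast
qed

end
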